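(* Let $k\ge 2$ be an integer and let $S\subseteq\{0,\ldots,k-1\}$. Suppose that for every real parameter $x\in(0,1)$, the following linear system of three equations in the real variables $\{p_i : i\in\{0,\ldots,k-1\}\setminus S\}$ has a nonnegative solution (a solution in which every coordinate is nonnegative): $$\sum_{i\in\{0,\ldots,k-1\}\setminus S}\frac{x^{i-2}}{(i-2)!}\frac{(1-x)^{k-1-i}}{(k-1-i)!}\,p_i=1,$$ $$\sum_{i\in\{0,\ldots,k-1\}\setminus S}\frac{x^{i}}{i!}\frac{(1-x)^{k-3-i}}{(k-3-i)!}\,p_i=1,$$ $$\sum_{i\in\{0,\ldots,k-1\}\setminus S}\frac{x^{i-1}}{(i-1)!}\frac{(1-x)^{k-2-i}}{(k-2-i)!}\,p_i=1,$$ where any term containing the factorial of a negative integer in a denominator is interpreted as $0$. Then $\mathcal{F}(S,k)$ is avoidable.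
   Context: Let $k\ge 2$. A red-blue edge coloring of $K_k$ is identified with the graph on $k$ vertices formed by its blue edges (the red edges being the non-edges); $\mathcal{C}(k)$ is the set of all red-blue edge colorings of $K_k$, equivalently of all graphs on $k$ vertices, considered up to isomorphism. For $X\subseteq\mathcal{C}(k)$, an $X$-packing of a red-blue edge coloring of $K_n$ is a set of pairwise edge-disjoint colored copies of $K_k$ in this colored $K_n$, each isomorphic (as a colored graph) to an element of $X$; its size is the number of copies. (Equivalently: for the blue graph $G$ on $n$ vertices, a set of $k$-element vertex subsets, any two sharing at most one vertex, each inducing in $G$ a graph isomorphic to a member of $X$.) $X$ has the asymptotic packing property if for every $\epsilon>0$ and all sufficiently large $n$, every red-blue edge coloring of $K_n$ has an $X$-packing of size at least $\frac{n(n-1)}{k(k-1)}(1-\epsilon)$. A family $\mathcal{F}\subseteq\mathcal{C}(k)$ is avoidable if $\mathcal{C}(k)\setminus\mathcal{F}$ has the asymptotic packing property. The degree set of a graph $G$ is $\{d(v) : v\in V(G)\}$; for $S\subseteq\{0,\ldots,k-1\}$, $\mathcal{F}(S,k)$ is the set of all graphs on $k$ vertices whose degree set is contained in $S$. *)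

theory Defs
  imports Complex_Main "HOL-Library.Ramsey"
begin

text \<open>
  A red-blue edge coloring of the complete graph on a vertex set \<open>V\<close> is represented by the set of
  its blue edges, a set of 2-element subsets of \<open>V\<close>; equivalently, it is a simple graph on \<open>V\<close>.
\<close>

definition colorings :: "'a set \<Rightarrow> 'a set set set"
  where "colorings V = Pow ([V]\<^bsup>2\<^esup>)"

definition coloring_iso :: "'a set \<Rightarrow> 'a set set \<Rightarrow> 'b set \<Rightarrow> 'b set set \<Rightarrow> bool"
  where "coloring_iso V E W F \<longleftrightarrow> (\<exists>f. bij_betw f V W \<and> (\<lambda>e. f ` e) ` E = F)"

definition induced :: "'a set set \<Rightarrow> 'a set \<Rightarrow> 'a set set"
  where "induced E A = E \<inter> [A]\<^bsup>2\<^esup>"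

definition iso_rel :: "nat \<Rightarrow> (nat set set \<times> nat set set) set"
  where "iso_rel k = {(E, F). E \<in> colorings {..<k} \<and> F \<in> colorings {..<k} \<and>
                              coloring_iso {..<k} E {..<k} F}"

text \<open>
  The elements of \<open>\<C> k\<close> are isomorphism classes of colorings (see \<open>equiv_iso_rel\<close> below).
\<close>

definition coloring_classes :: "nat \<Rightarrow> nat set set set set" (\<open>\<C>\<close>)
  where "\<C> k = colorings {..<k} // iso_rel k"

text \<open>
  A copy of the complete graph on \<open>k\<close> vertices inside the complete graph on \<open>V\<close> is represented by
  its vertex set \<open>A\<close>; its edge set is \<open>[A]\<^bsup>2\<^esup>\<close>, and \<open>induced E A\<close> is the coloring it inherits.
\<close>

definition is_packing ::
  "nat \<Rightarrow> nat set set set set \<Rightarrow> 'a set \<Rightarrow> 'a set set \<Rightarrow> 'a set set \<Rightarrow> bool"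
  where "is_packing k X V E P \<longleftrightarrow>
    P \<subseteq> [V]\<^bsup>k\<^esup> \<and>
    (\<forall>A\<in>P. \<exists>c\<in>X. \<exists>H\<in>c. coloring_iso A (induced E A) {..<k} H) \<and>
    pairwise (\<lambda>A B. disjnt ([A]\<^bsup>2\<^esup>) ([B]\<^bsup>2\<^esup>)) P"

definition asymptotic_packing_property :: "nat \<Rightarrow> nat set set set set \<Rightarrow> bool"
  where "asymptotic_packing_property k X \<longleftrightarrow>
    (\<forall>\<epsilon>::real. \<epsilon> > 0 \<longrightarrow>
      (\<forall>\<^sub>F n in sequentially. \<forall>E \<in> colorings {..<n}. \<exists>P.
         is_packing k X {..<n} E P \<and>
         real (card P) \<ge> real n * (real n - 1) / (real k * (real k - 1)) * (1 - \<epsilon>)))"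

definition avoidable :: "nat \<Rightarrow> nat set set set set \<Rightarrow> bool"
  where "avoidable k \<F> \<longleftrightarrow> \<F> \<subseteq> \<C> k \<and> asymptotic_packing_property k (\<C> k - \<F>)"

definition degree :: "'a set set \<Rightarrow> 'a \<Rightarrow> nat"
  where "degree E v = card {e \<in> E. v \<in> e}"

definition degree_set :: "'a set \<Rightarrow> 'a set set \<Rightarrow> nat set"
  where "degree_set V E = degree E ` V"

text \<open>
  Isomorphic colorings have the same degree set (\<open>degree_set_iso\<close> below), so the
  choice of representative is irrelevant here.
\<close>

definition degree_family :: "nat set \<Rightarrow> nat \<Rightarrow> nat set set set set"
  where "degree_family S k = {c \<in> \<C> k. \<forall>E\<in>c. degree_set {..<k} E \<subseteq> S}"

text \<open>
  The expression \<open>x\<^sup>m / m!\<close> for an integer \<open>m\<close>, with the convention that it is \<open>0\<close> for negative \<open>m\<close>.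
\<close>

definition pow_div_fact :: "real \<Rightarrow> int \<Rightarrow> real"
  where "pow_div_fact x m = (if m < 0 then 0 else x powi m / fact (nat m))"

lemma coloring_iso_refl: "coloring_iso V E V E"
  unfolding coloring_iso_def by (rule exI[of _ id]) auto

lemma coloring_iso_sym:
  assumes "E \<in> colorings V" "coloring_iso V E W F"
  shows "coloring_iso W F V E"
proof -
  obtain f where f: "bij_betw f V W" "(\<lambda>e. f ` e) ` E = F"
    using assms(2) by (auto simp: coloring_iso_def)
  have "inv_into V f ` f ` e = e" if "e \<in> E" for e
  proof -
    have "e \<subseteq> V" using that assms(1) by (auto simp: colorings_def nsets_def)
    then show ?thesis
      using f(1) by (simp add: bij_betw_def inv_into_image_cancel)
  qed
  then have "(\<lambda>e. inv_into V f ` e) ` F = E"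
    unfolding f(2)[symmetric] image_image by simp
  then show ?thesis
    unfolding coloring_iso_def using bij_betw_inv_into[OF f(1)] by blast
qed

lemma coloring_iso_trans:
  assumes "coloring_iso V E W F" "coloring_iso W F U G"
  shows "coloring_iso V E U G"
proof -
  obtain f g where f: "bij_betw f V W" "(\<lambda>e. f ` e) ` E = F"
    and g: "bij_betw g W U" "(\<lambda>e. g ` e) ` F = G"
    using assms by (auto simp: coloring_iso_def)
  have "(\<lambda>e. (g \<circ> f) ` e) ` E = G"
    unfolding g(2)[symmetric] f(2)[symmetric] image_image by (simp add: image_comp)
  then show ?thesis
    unfolding coloring_iso_def using bij_betw_trans[OF f(1) g(1)] by blast
qed

lemma equiv_iso_rel: "equiv (colorings {..<k}) (iso_rel k)"
proof (rule equivI)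
  show "iso_rel k \<subseteq> colorings {..<k} \<times> colorings {..<k}"
    by (auto simp: iso_rel_def)
  show "refl_on (colorings {..<k}) (iso_rel k)"
    by (auto simp: refl_on_def iso_rel_def coloring_iso_refl)
  show "sym (iso_rel k)"
    by (auto simp: sym_def iso_rel_def intro: coloring_iso_sym)
  show "trans (iso_rel k)"
    by (auto simp: trans_def iso_rel_def intro: coloring_iso_trans)
qed

lemma degree_set_iso:
  assumes E: "E \<in> colorings V" and iso: "coloring_iso V E W F"
  shows "degree_set V E = degree_set W F"
proof -
  obtain f where f: "bij_betw f V W" "(\<lambda>e. f ` e) ` E = F"
    using iso by (auto simp: coloring_iso_def)
  have inj: "inj_on f V" and W: "W = f ` V"
    using f(1) by (auto simp: bij_betw_def)
  have sub: "e \<subseteq> V" if "e \<in> E" for e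
    using that E by (auto simp: colorings_def nsets_def)
  have "degree F (f v) = degree E v" if v: "v \<in> V" for v
  proof -
    have "{e \<in> F. f v \<in> e} = (\<lambda>e. f ` e) ` {e \<in> E. v \<in> e}"
      unfolding f(2)[symmetric] using inj v sub by (auto dest: inj_onD)
    moreover have "inj_on (\<lambda>e. f ` e) {e \<in> E. v \<in> e}"
      by (rule inj_onI) (use inj sub in \<open>auto simp: inj_on_image_eq_iff\<close>)
    ultimately show ?thesis
      by (simp add: degree_def card_image)
  qed
  then show ?thesis
    by (auto simp: degree_set_def W image_image)
qed

end

theory Submission
  imports Defs
begin

text \<open>
  Write \<open>d\<^sub>K(v)\<close> for the blue degree of \<open>v\<close> inside a copy \<open>K\<close> of the complete graph on \<open>k\<close> vertices. Such a
  copy may be used as soon as one of its vertices, its root, has \<open>d\<^sub>K(v) \<notin> S\<close>. The idea is to pack rooted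
  copies, at first fractionally. Let \<open>v\<close> have blue degree \<open>x n\<close> in the whole graph, and give weight
  \<open>p\<^sub>i\<close> to every copy that contains \<open>v\<close> and in which \<open>v\<close> has degree \<open>i \<notin> S\<close>. The three equations say that
  each pair of blue neighbours of \<open>v\<close>, each pair of red neighbours, and each mixed pair then receives, up to
  lower order terms, the same weight \<open>n\<^bsup>k-3\<^esup>\<close> from the root \<open>v\<close>. Double counting inside the copies shows that
  each pair containing \<open>v\<close> receives \<open>n\<^bsup>k-2\<^esup> / (k - 2)\<close> from it. Summed over all roots, every edge of the
  complete graph carries asymptotically the same total weight \<open>n\<^bsup>k-2\<^esup> k / (k - 2)\<close>, whatever the colouring is,
  so after scaling the usable copies form an almost perfect fractional packing.

  The solution \<open>p\<close> depends on \<open>x\<close> and need not be bounded as \<open>x\<close> tends to \<open>0\<close> or \<open>1\<close>. A bound is needed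
  both for the lower order terms and for the rounding below. So vertices with \<open>x < d\<close> only use
  copies in which they are isolated, and vertices with \<open>x > 1 - d\<close> only copies in which they are joined in blue
  to all other vertices. This covers slightly less but never overloads an edge
  (\<open>root_weight_exists\<close>), and it is possible because solvability of the system for \<open>x\<close> near \<open>0\<close> and near \<open>1\<close>
  forces \<open>0 \<notin> S\<close> and \<open>k - 1 \<notin> S\<close> (\<open>balanced_imp_isolated\<close>, \<open>balanced_imp_dominating\<close>). The loads are
  computed in \<open>sum_weight_edge_le\<close>, \<open>sum_weight_lower\<close> and \<open>sum_weight_pair_le\<close>.

  It remains to round a fractional packing to an integral one
  (\<open>fractional_to_integral_matching\<close>): in a uniform hypergraph, a fractional matching that puts little
  weight on the hyperedges through any two given vertices can be replaced by a matching of almost the same size.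
  The hyperedges here are the edge sets of the copies; bounded weights make the weight through two
  edges \<open>O(1/n)\<close>. The rounding is a random greedy algorithm that draws one hyperedge
  at a time. The probability \<open>P\<^sub>t(F)\<close> that a set \<open>F\<close> of vertices is still uncovered obeys a recursion that
  expresses \<open>P\<^sub>t\<^sub>+\<^sub>1(F)\<close> by \<open>P\<^sub>t(F)\<close> and the values \<open>P\<^sub>t(F \<union> K)\<close>, and by comparison with this hierarchy
  \<open>P\<^sub>t(F)\<close> stays close to \<open>\<rho>\<^sub>t ^ |F|\<close>, where \<open>\<rho>\<^sub>t\<close> is a number that tends to \<open>0\<close>
  (\<open>accurate_one_step\<close>, \<open>accurate_block\<close>, \<open>accurate_uniformly\<close>). Only expectations enter; no
  concentration inequality is used.
\<close>

section \<open>Rounding fractional matchings of hypergraphs\<close>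

lemma power_one_minus_approx:
  fixes y :: real
  assumes "0 \<le> y" "y \<le> 1"
  shows "\<bar>(1 - y) ^ s - (1 - real s * y)\<bar> \<le> (real s)\<^sup>2 * y\<^sup>2"
proof -
  have lower: "1 - real s * y \<le> (1 - y) ^ s"
    using Bernoulli_inequality[of "- y" s] assms by simp
  have "(1 - y) ^ s \<le> 1 - real s * y + (real s)\<^sup>2 * y\<^sup>2"
  proof (induction s)
    case (Suc s)
    have "(1 - y) ^ Suc s \<le> (1 - real s * y + (real s)\<^sup>2 * y\<^sup>2) * (1 - y)"
      using mult_right_mono[OF Suc, of "1 - y"] assms by (simp add: mult.commute)
    also have "\<dots> = 1 - real (Suc s) * y + (real (Suc s))\<^sup>2 * y\<^sup>2
        - ((real s + 1) * y\<^sup>2 + (real s)\<^sup>2 * y ^ 3)"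
      by (simp add: power2_eq_square power3_eq_cube algebra_simps)
    also have "\<dots> \<le> 1 - real (Suc s) * y + (real (Suc s))\<^sup>2 * y\<^sup>2"
    proof -
      have "0 \<le> (real s + 1) * y\<^sup>2" "0 \<le> (real s)\<^sup>2 * y ^ 3" using assms by auto
      then show ?thesis by linarith
    qed
    finally show ?case .
  qed simp
  with lower show ?thesis by simp
qed

text \<open>
  The setting of the rounding. Hyperedges are indexed, \<open>c\<close> having vertex set \<open>e c\<close>; \<open>w\<close> is a fractional
  matching and \<open>\<kappa>\<close> bounds its codegrees. One step of the random process takes hyperedge \<open>c\<close> with
  probability \<open>h * w c\<close>, so \<open>h\<close> is the length of a time step; \<open>h_card\<close> guarantees that these
  probabilities add up to at most \<open>1\<close>.
\<close>

locale nibble =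
  fixes V :: "'a set" and I :: "'b set" and e :: "'b \<Rightarrow> 'a set" and w :: "'b \<Rightarrow> real"
    and r :: nat and \<kappa> h :: real
  assumes finite_V: "finite V" and finite_I: "finite I"
    and edge_subset: "c \<in> I \<Longrightarrow> e c \<subseteq> V" and card_edge: "c \<in> I \<Longrightarrow> card (e c) = r"
    and r_pos: "0 < r"
    and w_nonneg: "c \<in> I \<Longrightarrow> 0 \<le> w c"
    and deg_le: "f \<in> V \<Longrightarrow> (\<Sum>c | c \<in> I \<and> f \<in> e c. w c) \<le> 1"
    and codeg_le: "f \<in> V \<Longrightarrow> g \<in> V \<Longrightarrow> f \<noteq> g \<Longrightarrow>
      (\<Sum>c | c \<in> I \<and> f \<in> e c \<and> g \<in> e c. w c) \<le> \<kappa>"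
    and \<kappa>_nonneg: "0 \<le> \<kappa>"
    and h_pos: "0 < h" and h_le_1: "h \<le> 1" and h_card: "h * real (card V) \<le> 1"
begin

definition deg :: "'a \<Rightarrow> real"
  where "deg f = (\<Sum>c\<in>I. w c * of_bool (f \<in> e c))"

text \<open>
  The process is easy to control when all degrees equal \<open>1\<close>. The missing amount at a vertex \<open>f\<close> is made up by
  deleting \<open>f\<close> alone, at the rate at which the missing hyperedges would be expected to cover it.
\<close>

definition slack :: "'a \<Rightarrow> real"
  where "slack f = 1 - deg f"

text \<open>
  The predicted probability that a vertex is still uncovered after \<open>t\<close> steps: it survives a step unless one of
  its hyperedges, all of whose \<open>r\<close> vertices must still be uncovered, is drawn.
\<close>

primrec \<rho> :: "nat \<Rightarrow> real"
  where "\<rho> 0 = 1" | "\<rho> (Suc t) = \<rho> t - h * \<rho> t ^ r"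

text \<open>
  A state \<open>(L, M)\<close> consists of the live vertices and the indices of the hyperedges taken so far. The operator
  \<open>step q\<close> maps an observable to its conditional expectation after one step, in which a live vertex \<open>f\<close> is
  deleted alone with probability \<open>h * slack f * q\<close>. With this operator the whole analysis is linear
  algebra on functions of the state.
\<close>

definition step :: "real \<Rightarrow> ('a set \<times> 'b set \<Rightarrow> real) \<Rightarrow> 'a set \<times> 'b set \<Rightarrow> real"
  where "step q g = (\<lambda>(L, M). g (L, M) +
    h * ((\<Sum>c\<in>I. w c * of_bool (e c \<subseteq> L) * (g (L - e c, insert c M) - g (L, M))) +
         (\<Sum>f\<in>V. slack f * q * of_bool (f \<in> L) * (g (L - {f}, M) - g (L, M)))))"

text \<open>
  \<open>ev t g\<close> is the expectation of \<open>g\<close> after \<open>t\<close> steps. The deletion rate carries the factor \<open>\<rho> t ^ (r - 1)\<close>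
  because a hyperedge through a live vertex can be taken only if its other \<open>r - 1\<close> vertices are live too.
\<close>

primrec ev :: "nat \<Rightarrow> ('a set \<times> 'b set \<Rightarrow> real) \<Rightarrow> real"
  where "ev 0 g = g (V, {})" | "ev (Suc t) g = ev t (step (\<rho> t ^ (r - 1)) g)"

definition admissible :: "'a set \<times> 'b set \<Rightarrow> bool"
  where "admissible = (\<lambda>(L, M). L \<subseteq> V \<and> M \<subseteq> I \<and> pairwise (\<lambda>c d. disjnt (e c) (e d)) M \<and>
    (\<forall>c\<in>M. disjnt (e c) L))"

definition alive :: "'a set \<Rightarrow> 'a set \<times> 'b set \<Rightarrow> real"
  where "alive F = (\<lambda>(L, M). of_bool (F \<subseteq> L))"

text \<open>
  The prediction \<open>\<rho> t ^ card F\<close> is compared with the true survival probability for all small vertex sets. The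
  levels \<open>j\<close> are spaced by \<open>r\<close>, so that adding one hyperedge to a set of level \<open>j\<close> gives a set of level
  \<open>j + 1\<close>.
\<close>

definition accurate :: "nat \<Rightarrow> nat \<Rightarrow> real \<Rightarrow> bool"
  where "accurate j t a \<longleftrightarrow>
    (\<forall>F\<subseteq>V. card F \<le> r * (j + 1) \<longrightarrow> \<bar>ev t (alive F) - \<rho> t ^ card F\<bar> \<le> a)"

lemma deg_le': "f \<in> V \<Longrightarrow> deg f \<le> 1"
  using deg_le[of f] finite_I
  by (simp add: deg_def sum.inter_filter of_bool_def if_distrib cong: if_cong)

lemma slack_nonneg: "f \<in> V \<Longrightarrow> 0 \<le> slack f"
  using deg_le' by (simp add: slack_def)

lemma sum_deg:
  assumes "finite F"
  shows "(\<Sum>c\<in>I. w c * real (card (e c \<inter> F))) = (\<Sum>f\<in>F. deg f)"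
proof -
  have "real (card (e c \<inter> F)) = (\<Sum>f\<in>F. of_bool (f \<in> e c))" for c
    using assms by (simp add: sum.inter_filter[symmetric] of_bool_def Int_def conj_commute)
  then show ?thesis
    by (simp add: deg_def sum_distrib_left sum.swap[of _ I])
qed

lemma sum_w_le_deg: "(\<Sum>c\<in>I. w c) \<le> (\<Sum>f\<in>V. deg f)"
proof -
  have "w c \<le> w c * real (card (e c \<inter> V))" if "c \<in> I" for c
    using mult_left_mono[of 1 "real r" "w c"] that w_nonneg[OF that] r_pos edge_subset[OF that]
      card_edge[OF that] by (simp add: Int_absorb2)
  then have "(\<Sum>c\<in>I. w c) \<le> (\<Sum>c\<in>I. w c * real (card (e c \<inter> V)))"
    by (rule sum_mono)
  then show ?thesis using sum_deg[OF finite_V] by simp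
qed

lemma sum_codeg:
  assumes "F \<subseteq> V"
  shows "(\<Sum>c\<in>I. w c * (real (card (e c \<inter> F)) * (real (card (e c \<inter> F)) - 1)))
    \<le> (real (card F))\<^sup>2 * \<kappa>"
proof -
  have finF: "finite F" using assms finite_V finite_subset by blast
  have "real (card A) * (real (card A) - 1) =
      (\<Sum>f\<in>F. \<Sum>g\<in>F - {f}. of_bool (f \<in> A \<and> g \<in> A))" if "A \<subseteq> F" for A
  proof -
    have finA: "finite A" using that finF finite_subset by blast
    have "(\<Sum>g\<in>F - {f}. of_bool (f \<in> A \<and> g \<in> A)) = of_bool (f \<in> A) * (real (card A) - 1)" for f
    proof (cases "f \<in> A")
      case True
      have "{g \<in> F - {f}. g \<in> A} = A - {f}" using that by auto
      then have "(\<Sum>g\<in>F - {f}. of_bool (f \<in> A \<and> g \<in> A)) = real (card (A - {f}))"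
        using True finF by (simp add: of_bool_def sum.inter_filter[symmetric])
      moreover have "card A > 0" using True finA card_gt_0_iff by blast
      ultimately show ?thesis using True finA by (simp add: of_nat_diff Suc_leI)
    qed simp
    moreover have "(\<Sum>f\<in>F. of_bool (f \<in> A)) = real (card A)"
    proof -
      have "{f \<in> F. f \<in> A} = A" using that by auto
      then show ?thesis using finF by (simp add: of_bool_def sum.inter_filter[symmetric])
    qed
    ultimately show ?thesis by (simp add: sum_distrib_right[symmetric])
  qed
  from this[of "e _ \<inter> F"]
  have "(\<Sum>c\<in>I. w c * (real (card (e c \<inter> F)) * (real (card (e c \<inter> F)) - 1)))
     = (\<Sum>c\<in>I. \<Sum>f\<in>F. \<Sum>g\<in>F - {f}. w c * of_bool (f \<in> e c \<inter> F \<and> g \<in> e c \<inter> F))"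
    by (simp add: sum_distrib_left)
  also have "\<dots> = (\<Sum>f\<in>F. \<Sum>g\<in>F - {f}. \<Sum>c\<in>I. w c * of_bool (f \<in> e c \<inter> F \<and> g \<in> e c \<inter> F))"
    by (subst sum.swap) (intro sum.cong refl sum.swap)
  also have "\<dots> \<le> (\<Sum>f\<in>F. \<Sum>g\<in>F - {f}. \<kappa>)"
  proof (intro sum_mono)
    fix f g assume fg: "f \<in> F" "g \<in> F - {f}"
    have "(\<Sum>c\<in>I. w c * of_bool (f \<in> e c \<inter> F \<and> g \<in> e c \<inter> F)) =
        (\<Sum>c | c \<in> I \<and> f \<in> e c \<and> g \<in> e c. w c)"
      using fg finite_I
      by (simp add: sum.inter_filter of_bool_def if_distrib cong: if_cong)
    then show "(\<Sum>c\<in>I. w c * of_bool (f \<in> e c \<inter> F \<and> g \<in> e c \<inter> F)) \<le> \<kappa>"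
      using codeg_le[of f g] fg assms by auto
  qed
  also have "\<dots> \<le> (\<Sum>f\<in>F. \<Sum>g\<in>F. \<kappa>)"
    using finF \<kappa>_nonneg by (intro sum_mono sum_mono2) auto
  finally show ?thesis by (simp add: power2_eq_square mult.assoc)
qed

lemma \<rho>_bounds: "0 \<le> \<rho> t \<and> \<rho> t \<le> 1"
proof (induction t)
  case (Suc t)
  have "\<rho> t ^ r \<le> \<rho> t"
    using Suc r_pos power_decreasing[of 1 r "\<rho> t"] by simp
  moreover have "h * \<rho> t ^ r \<le> \<rho> t ^ r" "0 \<le> h * \<rho> t ^ r"
    using Suc h_pos h_le_1 by (auto simp: mult_left_le_one_le)
  ultimately show ?case using Suc by simp
qed simp

lemma step_linear:
  assumes "finite X"
  shows "step q (\<lambda>s. a * g s + (\<Sum>x\<in>X. b x * G x s)) s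
    = a * step q g s + (\<Sum>x\<in>X. b x * step q (G x) s)"
proof (cases s)
  case (Pair L M)
  let ?A = "\<lambda>g. \<Sum>c\<in>I. w c * of_bool (e c \<subseteq> L) * (g (L - e c, insert c M) - g (L, M))"
  let ?B = "\<lambda>g. \<Sum>f\<in>V. slack f * q * of_bool (f \<in> L) * (g (L - {f}, M) - g (L, M))"
  have sum_b: "(\<Sum>x\<in>X. b x * u x) - (\<Sum>x\<in>X. b x * v x) = (\<Sum>x\<in>X. b x * (u x - v x))"
    for u v :: "_ \<Rightarrow> real" by (simp add: sum_subtractf algebra_simps)
  have pull: "y * (a * u + (\<Sum>x\<in>X. b x * u' x) - (a * v + (\<Sum>x\<in>X. b x * v' x)))
     = a * (y * (u - v)) + (\<Sum>x\<in>X. b x * (y * (u' x - v' x)))" for y u v :: real and u' v'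
  proof -
    have "a * u + (\<Sum>x\<in>X. b x * u' x) - (a * v + (\<Sum>x\<in>X. b x * v' x))
      = a * (u - v) + (\<Sum>x\<in>X. b x * (u' x - v' x))"
      using sum_b[of u' v'] by (simp add: algebra_simps)
    then show ?thesis by (simp add: sum_distrib_left algebra_simps)
  qed
  have A: "?A (\<lambda>s. a * g s + (\<Sum>x\<in>X. b x * G x s)) = a * ?A g + (\<Sum>x\<in>X. b x * ?A (G x))"
    by (simp only: pull sum.distrib sum_distrib_left sum.swap[of _ I])
  have B: "?B (\<lambda>s. a * g s + (\<Sum>x\<in>X. b x * G x s)) = a * ?B g + (\<Sum>x\<in>X. b x * ?B (G x))"
    by (simp only: pull sum.distrib sum_distrib_left sum.swap[of _ V])
  show ?thesis
    unfolding step_def Pair prod.case A B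
    by (simp add: sum.distrib sum_distrib_left algebra_simps)
qed

lemma ev_linear:
  assumes "finite X"
  shows "ev t (\<lambda>s. a * g s + (\<Sum>x\<in>X. b x * G x s)) = a * ev t g + (\<Sum>x\<in>X. b x * ev t (G x))"
proof (induction t arbitrary: g G)
  case (Suc t)
  have "step (\<rho> t ^ (r - 1)) (\<lambda>s. a * g s + (\<Sum>x\<in>X. b x * G x s))
    = (\<lambda>s. a * step (\<rho> t ^ (r - 1)) g s + (\<Sum>x\<in>X. b x * step (\<rho> t ^ (r - 1)) (G x) s))"
    by (intro ext step_linear assms)
  then show ?case by (simp add: Suc)
qed simp

lemma ev_const: "ev t (\<lambda>_. a) = a"
  by (induction t) (simp_all add: step_def case_prod_unfold)

lemma admissible_init: "admissible (V, {})"
  by (simp add: admissible_def)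

lemma admissible_take:
  assumes "admissible (L, M)" "c \<in> I" "e c \<subseteq> L"
  shows "admissible (L - e c, insert c M)"
  using assms unfolding admissible_def
  by (auto simp: pairwise_insert disjnt_iff subset_iff)

lemma admissible_drop: "admissible (L, M) \<Longrightarrow> admissible (L - {f}, M)"
  unfolding admissible_def by (auto simp: disjnt_iff)

text \<open>
  One step is an average with nonnegative weights over states that are again admissible. This is where the
  time step has to be short enough.
\<close>

lemma step_mono:
  assumes q: "0 \<le> q" "q \<le> 1"
    and le: "\<And>s. admissible s \<Longrightarrow> g s \<le> g' s" and s: "admissible s"
  shows "step q g s \<le> step q g' s"
proof (cases s)
  case (Pair L M)
  let ?a = "\<lambda>c. w c * of_bool (e c \<subseteq> L)" and ?b = "\<lambda>f. slack f * q * of_bool (f \<in> L)"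
  have form: "step q g s = (1 - h * (sum ?a I + sum ?b V)) * g (L, M) +
      h * ((\<Sum>c\<in>I. ?a c * g (L - e c, insert c M)) + (\<Sum>f\<in>V. ?b f * g (L - {f}, M)))" for g
    unfolding step_def Pair
    by (simp only: prod.case right_diff_distrib sum_subtractf sum_distrib_right[symmetric])
      (simp add: algebra_simps)
  have "sum ?a I + sum ?b V \<le> sum w I + sum slack V"
  proof (intro add_mono sum_mono)
    show "slack f * q * of_bool (f \<in> L) \<le> slack f" if "f \<in> V" for f
      using slack_nonneg[OF that] q by (auto simp: mult_left_le)
  qed (auto simp: w_nonneg)
  also have "\<dots> \<le> real (card V)"
    using sum_w_le_deg by (simp add: slack_def sum_subtractf)
  finally have "h * (sum ?a I + sum ?b V) \<le> h * real (card V)"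
    using h_pos by (intro mult_left_mono) auto
  then have nonneg: "0 \<le> 1 - h * (sum ?a I + sum ?b V)" using h_card by simp
  have take: "?a c * g (L - e c, insert c M) \<le> ?a c * g' (L - e c, insert c M)" if "c \<in> I" for c
    using le[OF admissible_take[of L M c]] s that w_nonneg[OF that] unfolding Pair
    by (cases "e c \<subseteq> L") (auto intro: mult_left_mono)
  have drop: "?b f * g (L - {f}, M) \<le> ?b f * g' (L - {f}, M)" if "f \<in> V" for f
    using le[OF admissible_drop[of L M f]] s q slack_nonneg[OF that] unfolding Pair
    by (intro mult_left_mono) auto
  show ?thesis unfolding form
    using nonneg h_pos le[OF s] take drop unfolding Pair
    by (intro add_mono mult_left_mono[of _ _ "1 - _"] mult_left_mono[of _ _ h] sum_mono) auto
qed

lemma \<rho>_power_bounds: "0 \<le> \<rho> t ^ m" "\<rho> t ^ m \<le> 1"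
  using \<rho>_bounds[of t] by (auto simp: power_le_one)

lemma ev_mono:
  assumes "\<And>s. admissible s \<Longrightarrow> g s \<le> g' s"
  shows "ev t g \<le> ev t g'"
  using assms
proof (induction t arbitrary: g g')
  case (Suc t)
  show ?case unfolding ev.simps
    by (rule Suc.IH, rule step_mono) (use Suc.prems \<rho>_power_bounds in auto)
qed (simp add: admissible_init)

lemma ev_alive_bounds: "0 \<le> ev t (alive F)" "ev t (alive F) \<le> 1"
  using ev_mono[of "\<lambda>_. 0" "alive F" t] ev_mono[of "alive F" "\<lambda>_. 1" t]
  by (simp_all add: ev_const alive_def case_prod_unfold)

text \<open>
  The set \<open>F\<close> dies when a live hyperedge meeting it is taken; hence the product of the indicators of \<open>F\<close> and of
  that hyperedge, which is the indicator of their union. Thus the indicators of survival are mapped to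
  combinations of such indicators, and their expectations satisfy a recursion that only involves larger sets.
\<close>

lemma step_alive:
  assumes F: "F \<subseteq> V"
  shows "step q (alive F) s = (1 - h * (\<Sum>f\<in>F. slack f * q)) * alive F s +
    (\<Sum>c\<in>{c \<in> I. e c \<inter> F \<noteq> {}}. (- h * w c) * alive (F \<union> e c) s)"
proof (cases s)
  case (Pair L M)
  have "(\<Sum>c\<in>I. w c * of_bool (e c \<subseteq> L) * (alive F (L - e c, insert c M) - alive F (L, M)))
     = (\<Sum>c\<in>I. if e c \<inter> F \<noteq> {} then - (w c * alive (F \<union> e c) (L, M)) else 0)"
    by (intro sum.cong) (auto simp: alive_def)
  also have "\<dots> = (\<Sum>c\<in>{c \<in> I. e c \<inter> F \<noteq> {}}. - (w c * alive (F \<union> e c) (L, M)))"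
    using finite_I by (simp add: sum.inter_filter)
  finally have A: "(\<Sum>c\<in>I. w c * of_bool (e c \<subseteq> L) * (alive F (L - e c, insert c M) - alive F (L, M)))
     = (\<Sum>c\<in>{c \<in> I. e c \<inter> F \<noteq> {}}. - (w c * alive (F \<union> e c) (L, M)))" .
  have "(\<Sum>f\<in>V. slack f * q * of_bool (f \<in> L) * (alive F (L - {f}, M) - alive F (L, M)))
     = (\<Sum>f\<in>V. if f \<in> F then - (slack f * q * alive F (L, M)) else 0)"
    by (intro sum.cong) (auto simp: alive_def)
  also have "\<dots> = (\<Sum>f\<in>F. - (slack f * q * alive F (L, M)))"
    using finite_V F by (simp add: sum.If_cases Int_absorb1)
  finally have B: "(\<Sum>f\<in>V. slack f * q * of_bool (f \<in> L) * (alive F (L - {f}, M) - alive F (L, M)))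
     = (\<Sum>f\<in>F. - (slack f * q * alive F (L, M)))" .
  show ?thesis unfolding Pair step_def prod.case A B
    by (simp add: sum_negf sum_distrib_left sum_distrib_right algebra_simps)
qed

lemma ev_alive_Suc:
  assumes F: "F \<subseteq> V"
  shows "ev (Suc t) (alive F) = ev t (alive F) - h * (
    (\<Sum>c\<in>{c \<in> I. e c \<inter> F \<noteq> {}}. w c * ev t (alive (F \<union> e c))) +
    (\<Sum>f\<in>F. slack f * \<rho> t ^ (r - 1) * ev t (alive F)))"
proof -
  have "step (\<rho> t ^ (r - 1)) (alive F) = (\<lambda>s. (1 - h * (\<Sum>f\<in>F. slack f * \<rho> t ^ (r - 1))) * alive F s +
    (\<Sum>c\<in>{c \<in> I. e c \<inter> F \<noteq> {}}. (- h * w c) * alive (F \<union> e c) s))"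
    by (intro ext step_alive F)
  then have "ev (Suc t) (alive F) = (1 - h * (\<Sum>f\<in>F. slack f * \<rho> t ^ (r - 1))) * ev t (alive F) +
    (\<Sum>c\<in>{c \<in> I. e c \<inter> F \<noteq> {}}. (- h * w c) * ev t (alive (F \<union> e c)))"
    by (simp only: ev.simps ev_linear[OF finite_subset[OF Collect_restrict finite_I]])
  also have "\<dots> = ev t (alive F) - h * (
    (\<Sum>c\<in>{c \<in> I. e c \<inter> F \<noteq> {}}. w c * ev t (alive (F \<union> e c))) +
    (\<Sum>f\<in>F. slack f * \<rho> t ^ (r - 1) * ev t (alive F)))"
    by (simp add: sum_negf sum_distrib_left sum_distrib_right algebra_simps)
  finally show ?thesis .
qed

text \<open>
  Comparing the recursion for survival probabilities with the one for powers of \<open>\<rho>\<close>: a hyperedge that meets \<open>F\<close> in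
  exactly one vertex contributes the error of the next level, those meeting it in more vertices are
  controlled by the codegrees, and together with the lonely deletions every vertex of \<open>F\<close> counts with total
  weight \<open>1\<close>. The term with \<open>h\<close> is the second order error of \<open>\<rho> (Suc t) ^ card F\<close>.
\<close>

lemma accurate_one_step:
  assumes a: "accurate j t a" and b: "accurate (Suc j) t b"
  shows "accurate j (Suc t) (a + h * (real (r * (j + 1)) * b + (real (r * (j + 1)))\<^sup>2 * (\<kappa> + h)))"
  unfolding accurate_def
proof (intro allI impI)
  fix F assume F: "F \<subseteq> V" and cardF: "card F \<le> r * (j + 1)"
  define s where "s = card F"
  define q where "q = \<rho> t"
  have finF: "finite F" using F finite_V finite_subset by blast
  have q: "0 \<le> q" "q \<le> 1" using \<rho>_bounds by (auto simp: q_def)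
  have qr: "q ^ r = q * q ^ (r - 1)" using r_pos by (cases r) auto
  have qp: "0 \<le> q ^ m" "q ^ m \<le> 1" for m using \<rho>_power_bounds[of t m] by (auto simp: q_def)
  let ?P = "\<lambda>F. ev t (alive F)"
  have devF: "\<bar>?P F - q ^ s\<bar> \<le> a" using a F cardF by (auto simp: accurate_def s_def q_def)
  have devF': "\<bar>?P F - q ^ s\<bar> \<le> b"
    using b F cardF by (auto simp: accurate_def s_def q_def)
  have b0: "0 \<le> b" using devF' by linarith
  define Q1 where "Q1 = (\<Sum>c\<in>{c \<in> I. e c \<inter> F \<noteq> {}}. w c * ?P (F \<union> e c))"
  define Q2 where "Q2 = (\<Sum>f\<in>F. slack f * q ^ (r - 1) * ?P F)"
  let ?m = "\<lambda>c. real (card (e c \<inter> F))"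
  \<comment> \<open>A hyperedge meeting \<open>F\<close> in \<open>m\<close> vertices is counted once by the process
    and \<open>m\<close> times by the prediction; the defect is charged to the \<open>m (m - 1)\<close> ordered pairs
    in the intersection.\<close>
  have pointwise: "\<bar>of_bool (e c \<inter> F \<noteq> {}) * ?P (F \<union> e c) - ?m c * q ^ (s + r - 1)\<bar>
      \<le> ?m c * b + ?m c * (?m c - 1)" if c: "c \<in> I" for c
  proof -
    have fin: "finite (e c \<inter> F)" using finF by simp
    consider "card (e c \<inter> F) = 0" | "card (e c \<inter> F) = 1" | "card (e c \<inter> F) \<ge> 2" by linarith
    then show ?thesis
    proof cases
      case 1
      then show ?thesis using fin by simp
    next
      case 2
      have fine: "finite (e c)" using edge_subset[OF c] finite_V finite_subset by blast
      have "card (F \<union> e c) + 1 = s + r"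
        using card_Un_Int[OF finF fine] 2 card_edge[OF c] by (simp add: s_def Int_commute)
      then have card: "card (F \<union> e c) = s + r - 1" by simp
      have "F \<union> e c \<subseteq> V" using F edge_subset[OF c] by simp
      moreover have "card (F \<union> e c) \<le> r * (Suc j + 1)" using card cardF by (simp add: s_def)
      ultimately have "\<bar>?P (F \<union> e c) - q ^ card (F \<union> e c)\<bar> \<le> b"
        using b by (auto simp: accurate_def q_def)
      moreover have "e c \<inter> F \<noteq> {}" using 2 by force
      ultimately show ?thesis using 2 card by simp
    next
      case 3
      let ?x = "of_bool (e c \<inter> F \<noteq> {}) * ?P (F \<union> e c)"
      have "0 \<le> ?x" "?x \<le> 1" using ev_alive_bounds by auto
      moreover have "0 \<le> ?m c * q ^ (s + r - 1)" "?m c * q ^ (s + r - 1) \<le> ?m c"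
        using qp[of "s + r - 1"] by (auto simp: mult_left_le)
      moreover have "?m c \<le> ?m c * (?m c - 1)" using 3 mult_left_mono[of 1 "?m c - 1" "?m c"] by simp
      moreover have "0 \<le> ?m c * b" using b0 by simp
      ultimately show ?thesis using 3 by linarith
    qed
  qed
  have Q1: "\<bar>Q1 - (\<Sum>f\<in>F. deg f) * q ^ (s + r - 1)\<bar> \<le> (\<Sum>f\<in>F. deg f) * b + (real s)\<^sup>2 * \<kappa>"
  proof -
    have "Q1 = (\<Sum>c\<in>I. w c * (of_bool (e c \<inter> F \<noteq> {}) * ?P (F \<union> e c)))"
      unfolding Q1_def using finite_I by (simp add: sum.inter_filter) (auto intro!: sum.cong)
    then have "Q1 - (\<Sum>f\<in>F. deg f) * q ^ (s + r - 1)
      = (\<Sum>c\<in>I. w c * (of_bool (e c \<inter> F \<noteq> {}) * ?P (F \<union> e c) - ?m c * q ^ (s + r - 1)))"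
      by (simp only: sum_deg[OF finF, symmetric] sum_distrib_right right_diff_distrib sum_subtractf
          mult.assoc)
    also have "\<bar>\<dots>\<bar> \<le> (\<Sum>c\<in>I. w c * (?m c * b + ?m c * (?m c - 1)))"
    proof (rule order.trans[OF sum_abs], rule sum_mono)
      fix c assume c: "c \<in> I"
      show "\<bar>w c * (of_bool (e c \<inter> F \<noteq> {}) * ?P (F \<union> e c) - ?m c * q ^ (s + r - 1))\<bar>
        \<le> w c * (?m c * b + ?m c * (?m c - 1))"
        unfolding abs_mult using w_nonneg[OF c] pointwise[OF c] by (simp add: mult_left_mono)
    qed
    also have "\<dots> = (\<Sum>f\<in>F. deg f) * b + (\<Sum>c\<in>I. w c * (?m c * (?m c - 1)))"
      by (simp only: sum_deg[OF finF, symmetric] sum_distrib_right distrib_left sum.distrib mult.assoc)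
    finally show ?thesis using sum_codeg[OF F] by (simp add: s_def)
  qed
  have slackF: "0 \<le> (\<Sum>f\<in>F. slack f)" using slack_nonneg F by (intro sum_nonneg) auto
  have Q2: "\<bar>Q2 - (\<Sum>f\<in>F. slack f) * q ^ (s + r - 1)\<bar> \<le> (\<Sum>f\<in>F. slack f) * b"
  proof -
    have "s + r - 1 = (r - 1) + s" using r_pos by simp
    then have "Q2 - (\<Sum>f\<in>F. slack f) * q ^ (s + r - 1)
      = (\<Sum>f\<in>F. slack f) * (q ^ (r - 1) * (?P F - q ^ s))"
      unfolding Q2_def by (simp add: sum_distrib_right power_add algebra_simps)
    moreover have "\<bar>q ^ (r - 1) * (?P F - q ^ s)\<bar> \<le> 1 * b"
      unfolding abs_mult using qp[of "r - 1"] devF' by (intro mult_mono) auto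
    ultimately show ?thesis using slackF by (simp add: abs_mult mult_left_mono)
  qed
  have total: "(\<Sum>f\<in>F. deg f) + (\<Sum>f\<in>F. slack f) = real s"
    by (simp add: slack_def sum_subtractf s_def)
  have Q: "\<bar>Q1 + Q2 - real s * q ^ (s + r - 1)\<bar> \<le> real s * b + (real s)\<^sup>2 * \<kappa>"
  proof -
    have "Q1 + Q2 - real s * q ^ (s + r - 1) = (Q1 - (\<Sum>f\<in>F. deg f) * q ^ (s + r - 1))
        + (Q2 - (\<Sum>f\<in>F. slack f) * q ^ (s + r - 1))"
      by (simp add: total[symmetric] algebra_simps)
    also have "\<bar>\<dots>\<bar> \<le> (\<Sum>f\<in>F. deg f) * b + (real s)\<^sup>2 * \<kappa> + (\<Sum>f\<in>F. slack f) * b"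
      using Q1 Q2 by linarith
    also have "\<dots> = real s * b + (real s)\<^sup>2 * \<kappa>"
      by (simp add: total[symmetric] algebra_simps)
    finally show ?thesis .
  qed
  have \<rho>: "\<bar>\<rho> (Suc t) ^ s - (q ^ s - h * (real s * q ^ (s + r - 1)))\<bar> \<le> (real s)\<^sup>2 * h\<^sup>2"
  proof -
    define y where "y = h * q ^ (r - 1)"
    have y: "0 \<le> y" "y \<le> h" using h_pos qp[of "r - 1"] by (auto simp: y_def mult_left_le)
    have "\<rho> (Suc t) = q * (1 - y)"
      by (simp add: q_def[symmetric] qr y_def right_diff_distrib)
    then have "\<rho> (Suc t) ^ s = q ^ s * (1 - y) ^ s" by (simp only: power_mult_distrib)
    moreover have "q ^ (s + r - 1) = q ^ s * q ^ (r - 1)"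
      using r_pos by (metis Nat.add_diff_assoc Suc_leI One_nat_def power_add)
    ultimately have "\<rho> (Suc t) ^ s - (q ^ s - h * (real s * q ^ (s + r - 1)))
      = q ^ s * ((1 - y) ^ s - (1 - real s * y))"
      by (simp add: y_def right_diff_distrib del: \<rho>.simps)
    moreover have "\<bar>(1 - y) ^ s - (1 - real s * y)\<bar> \<le> (real s)\<^sup>2 * y\<^sup>2"
      using y h_le_1 by (intro power_one_minus_approx) auto
    ultimately have "\<bar>\<rho> (Suc t) ^ s - (q ^ s - h * (real s * q ^ (s + r - 1)))\<bar>
       \<le> 1 * ((real s)\<^sup>2 * y\<^sup>2)"
      unfolding abs_mult using qp[of s] by (metis abs_of_nonneg abs_mult mult_mono abs_ge_zero zero_le_one)
    also have "\<dots> \<le> (real s)\<^sup>2 * h\<^sup>2"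
      using y by (simp add: mult_left_mono power_mono)
    finally show ?thesis .
  qed
  have "ev (Suc t) (alive F) = ?P F - h * (Q1 + Q2)"
    unfolding Q1_def Q2_def q_def by (rule ev_alive_Suc[OF F])
  then have "\<bar>ev (Suc t) (alive F) - \<rho> (Suc t) ^ s\<bar>
     \<le> \<bar>?P F - q ^ s\<bar> + \<bar>h * (Q1 + Q2 - real s * q ^ (s + r - 1))\<bar> + (real s)\<^sup>2 * h\<^sup>2"
    using \<rho> by (simp add: right_diff_distrib)
  also have "\<dots> \<le> a + h * (real s * b + (real s)\<^sup>2 * \<kappa>) + (real s)\<^sup>2 * h\<^sup>2"
    using devF Q h_pos by (intro add_mono) (auto simp: abs_mult)
  also have "\<dots> = a + h * (real s * b + (real s)\<^sup>2 * (\<kappa> + h))"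
    by (simp add: power2_eq_square algebra_simps)
  also have "\<dots> \<le> a + h * (real (r * (j + 1)) * b + (real (r * (j + 1)))\<^sup>2 * (\<kappa> + h))"
  proof -
    have "real s \<le> real (r * (j + 1))" using cardF unfolding s_def of_nat_le_iff .
    then show ?thesis using b0 h_pos \<kappa>_nonneg
      by (intro add_left_mono mult_left_mono add_mono mult_right_mono power_mono) auto
  qed
  finally show "\<bar>ev (Suc t) (alive F) - \<rho> (Suc t) ^ card F\<bar>
    \<le> a + h * (real (r * (j + 1)) * b + (real (r * (j + 1)))\<^sup>2 * (\<kappa> + h))"
    by (simp only: s_def)
qed

lemma accurate_mono: "accurate j t a \<Longrightarrow> a \<le> b \<Longrightarrow> accurate j t b"
  unfolding accurate_def by (meson order.trans)

lemma accurate_level_mono: "accurate j t a \<Longrightarrow> i \<le> j \<Longrightarrow> accurate i t a"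
  unfolding accurate_def by (meson order.trans mult_le_mono2 add_le_mono1)

lemma accurate_trivial: "1 \<le> a \<Longrightarrow> accurate j t a"
  unfolding accurate_def
proof (intro allI impI)
  fix F assume "1 \<le> a"
  then show "\<bar>ev t (alive F) - \<rho> t ^ card F\<bar> \<le> a"
    using ev_alive_bounds[of t F] \<rho>_power_bounds[of t "card F"] by linarith
qed

lemma accurate_initial: "0 \<le> a \<Longrightarrow> accurate j 0 a"
  unfolding accurate_def by (simp add: alive_def)

text \<open>
  The error at level \<open>j\<close> is driven by the error at level \<open>j + 1\<close>, and no estimate is available at the top
  level \<open>M\<close> except the trivial bound \<open>1\<close>. The geometric profile \<open>4 ^ j / 4 ^ M\<close> reaches \<open>1\<close> at level
  \<open>M\<close> and is preserved by the recursion up to a factor \<open>1 + 4 h r (M + 1)\<close> per step.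
\<close>

lemma accurate_block:
  assumes start: "accurate M t (1 / 4 ^ M)"
    and small: "(real (r * (M + 1)))\<^sup>2 * (\<kappa> + h) \<le> 1 / 4 ^ M"
    and "j \<le> M"
  shows "accurate j (t + u) (4 ^ j / 4 ^ M * (1 + 4 * h * real (r * (M + 1))) ^ u)"
  using \<open>j \<le> M\<close>
proof (induction u arbitrary: j)
  case 0
  have "(1::real) / 4 ^ M \<le> 4 ^ j / 4 ^ M" by (simp add: divide_right_mono)
  then show ?case using accurate_mono[OF accurate_level_mono[OF start 0]] by simp
next
  case (Suc u)
  define G where "G = 1 + 4 * h * real (r * (M + 1))"
  have G: "1 \<le> G" using h_pos by (simp add: G_def)
  show ?case
  proof (cases "j = M")
    case True
    have "1 \<le> G ^ Suc u" using G by (rule one_le_power)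
    then show ?thesis using True by (intro accurate_trivial) (simp add: G_def)
  next
    case False
    then have j: "j < M" using Suc.prems by simp
    let ?c = "\<lambda>j u. 4 ^ j / 4 ^ M * G ^ u"
    have "accurate j (t + u) (?c j u)" "accurate (Suc j) (t + u) (?c (Suc j) u)"
      using Suc.IH[of j] Suc.IH[of "Suc j"] j by (auto simp: G_def)
    from accurate_one_step[OF this]
    have "accurate j (Suc (t + u))
      (?c j u + h * (real (r * (j + 1)) * ?c (Suc j) u + (real (r * (j + 1)))\<^sup>2 * (\<kappa> + h)))" .
    moreover have "?c j u + h * (real (r * (j + 1)) * ?c (Suc j) u + (real (r * (j + 1)))\<^sup>2 * (\<kappa> + h))
       \<le> ?c j (Suc u)"
    proof -
      have "real (r * (j + 1)) \<le> real (r * (M + 1))"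
        using j unfolding of_nat_le_iff by (intro mult_le_mono) auto
      then have "(real (r * (j + 1)))\<^sup>2 * (\<kappa> + h) \<le> (real (r * (M + 1)))\<^sup>2 * (\<kappa> + h)"
        using h_pos \<kappa>_nonneg by (intro mult_right_mono power_mono) auto
      also note small
      also have "1 / 4 ^ M \<le> ?c (Suc j) u"
      proof -
        have "(1::real) * 1 \<le> 4 ^ Suc j * G ^ u" using G by (intro mult_mono one_le_power) auto
        then show ?thesis by (simp add: divide_right_mono)
      qed
      also have "?c (Suc j) u \<le> real r * ?c (Suc j) u"
      proof -
        have "1 \<le> real r" using r_pos by simp
        moreover have "0 \<le> ?c (Suc j) u" using G by simp
        ultimately show ?thesis using mult_right_mono[of 1 "real r" "?c (Suc j) u"] by simp
      qed
      finally have "real (r * (j + 1)) * ?c (Suc j) u + (real (r * (j + 1)))\<^sup>2 * (\<kappa> + h)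
         \<le> real (r * (j + 1)) * ?c (Suc j) u + real r * ?c (Suc j) u" by simp
      also have "\<dots> = real (r * (j + 2)) * ?c (Suc j) u"
        by (simp only: distrib_right[symmetric] of_nat_add[symmetric] of_nat_mult[symmetric])
          (simp add: algebra_simps)
      also have "\<dots> \<le> real (r * (M + 1)) * ?c (Suc j) u"
      proof (rule mult_right_mono)
        show "real (r * (j + 2)) \<le> real (r * (M + 1))"
          using j unfolding of_nat_le_iff by (intro mult_le_mono) auto
      qed (use G in simp)
      finally have "?c j u + h * (real (r * (j + 1)) * ?c (Suc j) u + (real (r * (j + 1)))\<^sup>2 * (\<kappa> + h))
         \<le> ?c j u + h * (real (r * (M + 1)) * ?c (Suc j) u)"
        using h_pos by (intro add_left_mono mult_left_mono) auto
      also have "?c (Suc j) u = 4 * ?c j u" by simp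
      also have "?c j u + h * (real (r * (M + 1)) * (4 * ?c j u)) = ?c j u * G"
        unfolding G_def[unfolded mult.assoc]
        by (simp only: distrib_left mult_1_right) (simp only: ac_simps)
      finally show ?thesis by (simp add: algebra_simps)
    qed
    ultimately show ?thesis using accurate_mono by (simp add: G_def)
  qed
qed

text \<open>
  Over a time span \<open>h u \<le> 1 / (4 r)\<close> the growth factor of \<open>accurate_block\<close> is beaten by \<open>4 ^ M\<close>, since
  \<open>exp 1 \<le> 3\<close>.
\<close>

lemma growth_bound:
  assumes "h * real r * real u \<le> 1 / 4"
  shows "(1 + 4 * h * real (r * (M + 1))) ^ u \<le> 3 ^ (M + 1)"
proof -
  have "(1 + 4 * h * real (r * (M + 1))) ^ u \<le> exp (4 * h * real (r * (M + 1))) ^ u"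
    using h_pos by (intro power_mono exp_ge_add_one_self) auto
  also have "\<dots> = exp (4 * (h * real r * real u) * real (M + 1))"
    by (simp only: exp_of_nat_mult[symmetric] of_nat_mult) (simp only: ac_simps)
  also have "\<dots> \<le> exp (1 * real (M + 1))"
    using assms by (intro iffD2[OF exp_le_cancel_iff] mult_right_mono) auto
  also have "\<dots> = exp 1 ^ (M + 1)" by (metis exp_of_nat_mult mult.commute)
  also have "\<dots> \<le> 3 ^ (M + 1)" by (intro power_mono exp_le) auto
  finally show ?thesis .
qed

text \<open>
  The matching grows with every hyperedge that is drawn while alive: such a hyperedge is new, because those
  taken earlier are disjoint from the set of live vertices.
\<close>

lemma ev_card_matching:
  "ev t (\<lambda>(L, M). real (card M)) \<ge> h * (\<Sum>i<t. \<Sum>c\<in>I. w c * ev i (alive (e c)))"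
proof (induction t)
  case (Suc t)
  let ?N = "\<lambda>(L :: 'a set, M :: 'b set). real (card M)"
  have "ev t (\<lambda>s. 1 * ?N s + (\<Sum>c\<in>I. h * w c * alive (e c) s)) \<le> ev t (step (\<rho> t ^ (r - 1)) ?N)"
  proof (rule ev_mono)
    fix s assume s: "admissible s"
    obtain L M where LM: "s = (L, M)" by (cases s)
    have new: "w c * of_bool (e c \<subseteq> L) * (real (card (insert c M)) - real (card M)) = w c * alive (e c) s"
      if c: "c \<in> I" for c
    proof (cases "e c \<subseteq> L")
      case True
      have "e c \<noteq> {}" using card_edge[OF c] r_pos by force
      then have "c \<notin> M" using s True unfolding LM admissible_def disjnt_def by fast
      moreover have "finite M" using s finite_I finite_subset unfolding LM admissible_def by auto
      ultimately show ?thesis using True by (simp add: alive_def LM)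
    qed (simp add: alive_def LM)
    have "step (\<rho> t ^ (r - 1)) ?N s
       = ?N s + h * (\<Sum>c\<in>I. w c * of_bool (e c \<subseteq> L) * (real (card (insert c M)) - real (card M)))"
      by (simp add: step_def LM)
    also have "\<dots> = ?N s + h * (\<Sum>c\<in>I. w c * alive (e c) s)"
      by (simp only: new cong: sum.cong)
    finally show "1 * ?N s + (\<Sum>c\<in>I. h * w c * alive (e c) s) \<le> step (\<rho> t ^ (r - 1)) ?N s"
      by (simp add: sum_distrib_left mult.assoc)
  qed
  then have "1 * ev t ?N + (\<Sum>c\<in>I. h * w c * ev t (alive (e c))) \<le> ev (Suc t) ?N"
    using finite_I by (simp only: ev_linear ev.simps)
  then show ?case using Suc by (simp add: sum_distrib_left algebra_simps)
qed simp

lemma \<rho>_telescope: "h * (\<Sum>i<t. \<rho> i ^ r) = 1 - \<rho> t"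
  by (induction t) (auto simp: algebra_simps)

lemma \<rho>_small:
  assumes "0 < d" and "h * real t * d ^ r \<ge> 1"
  shows "\<rho> t \<le> d"
proof (rule ccontr)
  assume "\<not> \<rho> t \<le> d"
  have "decseq \<rho>" using h_pos \<rho>_power_bounds(1) by (intro decseq_SucI) simp
  then have "d ^ r \<le> \<rho> i ^ r" if "i < t" for i
    using \<open>\<not> \<rho> t \<le> d\<close> decseqD[of \<rho> i t] that assms by (intro power_mono) auto
  then have "(\<Sum>i<t. d ^ r) \<le> (\<Sum>i<t. \<rho> i ^ r)" by (intro sum_mono) auto
  then have "h * (\<Sum>i<t. d ^ r) \<le> 1 - \<rho> t"
    using h_pos unfolding \<rho>_telescope[symmetric] by (intro mult_left_mono) auto
  then show False using assms \<open>\<not> \<rho> t \<le> d\<close> by (simp add: mult.assoc)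
qed

text \<open>
  A matching of maximal size is at least as large as the expected size. The expected number of hyperedges taken is
  about \<open>sum w I\<close> times \<open>h * (\<Sum>i<t. \<rho> i ^ r)\<close>, and this last sum telescopes to \<open>1 - \<rho> t\<close>.
\<close>

lemma matching_exists:
  assumes accurate: "\<And>i. i < t \<Longrightarrow> accurate 0 i a" and a: "0 \<le> a"
  obtains M where "M \<subseteq> I" "pairwise (\<lambda>c d. disjnt (e c) (e d)) M"
    "real (card M) \<ge> sum w I - real (card V) * (\<rho> t + h * real t * a)"
proof -
  have "\<exists>s. admissible s \<and> (\<forall>s'. admissible s' \<longrightarrow> card (snd s') \<le> card (snd s))"
  proof (rule ex_has_greatest_nat[of admissible "(V, {})" _ "Suc (card I)"])
    show "\<forall>s. admissible s \<longrightarrow> card (snd s) < Suc (card I)"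
      using finite_I by (auto simp: admissible_def less_Suc_eq_le intro: card_mono)
  qed (rule admissible_init)
  then obtain L M where LM: "admissible (L, M)"
    and max: "\<And>s. admissible s \<Longrightarrow> card (snd s) \<le> card M" by auto
  have W0: "0 \<le> sum w I" using w_nonneg by (intro sum_nonneg)
  have "(\<Sum>f\<in>V. deg f) \<le> real (card V)"
    using sum_mono[of V deg "\<lambda>_. 1"] deg_le' by simp
  then have W: "sum w I \<le> real (card V)" using sum_w_le_deg by linarith
  have "sum w I - real (card V) * (\<rho> t + h * real t * a) \<le> sum w I * (1 - \<rho> t - h * real t * a)"
    using mult_right_mono[OF W, of "\<rho> t + h * real t * a"] \<rho>_bounds[of t] a h_pos
    by (simp add: algebra_simps)
  also have "\<dots> = h * (\<Sum>i<t. \<Sum>c\<in>I. w c * (\<rho> i ^ r - a))"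
    by (simp add: sum_distrib_right[symmetric] sum_distrib_left[symmetric] sum_subtractf
        \<rho>_telescope[symmetric] algebra_simps)
  also have "\<dots> \<le> h * (\<Sum>i<t. \<Sum>c\<in>I. w c * ev i (alive (e c)))"
  proof (intro mult_left_mono sum_mono)
    fix i c assume i: "i \<in> {..<t}" and c: "c \<in> I"
    have "\<bar>ev i (alive (e c)) - \<rho> i ^ r\<bar> \<le> a"
      using accurate[of i] i edge_subset[OF c] card_edge[OF c] by (auto simp: accurate_def)
    then show "\<rho> i ^ r - a \<le> ev i (alive (e c))" by linarith
  qed (use h_pos w_nonneg in auto)
  also have "\<dots> \<le> ev t (\<lambda>(L, M). real (card M))" by (rule ev_card_matching)
  also have "\<dots> \<le> ev t (\<lambda>_. real (card M))"
    using max by (intro ev_mono) auto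
  also have "\<dots> = real (card M)" by (rule ev_const)
  finally show ?thesis using LM that by (auto simp: admissible_def)
qed

end

text \<open>
  For long times the estimate is restarted every \<open>B\<close> steps: to be accurate at level \<open>J\<close> at the end of a block one
  asks for more accuracy, and on more levels, at its beginning. Only finitely many blocks are needed
  whatever the hypergraph is, so the threshold \<open>\<theta>\<close> depends on \<open>r\<close>, the number of blocks, \<open>J\<close> and \<open>\<epsilon>\<close> only.
\<close>

lemma accurate_uniformly:
  fixes r i :: nat
  assumes "0 < \<epsilon>"
  shows "\<exists>\<theta>>0. \<forall>(V::'a set) (I::'b set) e w \<kappa> h B t.
    nibble V I e w r \<kappa> h \<longrightarrow> \<kappa> + h \<le> \<theta> \<longrightarrow> h * real r * real B \<le> 1 / 4 \<longrightarrow> t \<le> i * B \<longrightarrow>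
    nibble.accurate V I e w r h J t \<epsilon>"
  using assms
proof (induction i arbitrary: J \<epsilon>)
  case 0
  then show ?case by (intro exI[of _ 1]) (auto intro!: nibble.accurate_initial)
next
  case (Suc i)
  have "(\<lambda>M. 3 * 4 ^ J * (3 / 4) ^ M) \<longlonglongrightarrow> 3 * 4 ^ J * (0::real)"
    by (intro tendsto_mult tendsto_const LIMSEQ_power_zero) auto
  then have "\<forall>\<^sub>F M in sequentially. 3 * 4 ^ J * (3 / 4) ^ M < \<epsilon>"
    using Suc.prems by (intro order_tendstoD(2)) auto
  then obtain M where M: "J \<le> M" "3 * 4 ^ J * (3 / 4) ^ M < \<epsilon>"
    using eventually_ge_at_top[of J] by (metis (mono_tags, lifting) eventually_conj eventually_happens'
        sequentially_bot)
  obtain \<theta> where \<theta>: "\<theta> > 0" and IH: "\<And>(V::'a set) (I::'b set) e w \<kappa> h B t.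
    nibble V I e w r \<kappa> h \<Longrightarrow> \<kappa> + h \<le> \<theta> \<Longrightarrow> h * real r * real B \<le> 1 / 4 \<Longrightarrow> t \<le> i * B \<Longrightarrow>
    nibble.accurate V I e w r h M t (1 / 4 ^ M)"
    using Suc.IH[of "1 / 4 ^ M" M] by (metis zero_less_divide_1_iff zero_less_numeral zero_less_power)
  define \<theta>' where "\<theta>' = min \<theta> (1 / 4 ^ M / (real (r * (M + 1)) ^ 2 + 1))"
  have \<theta>': "0 < \<theta>'" "\<theta>' \<le> \<theta>" using \<theta> by (auto simp: \<theta>'_def divide_pos_pos add_nonneg_pos)
  have "nibble.accurate V I e w r h J t \<epsilon>"
    if nib: "nibble V I e w r \<kappa> h" and small: "\<kappa> + h \<le> \<theta>'" and B: "h * real r * real B \<le> 1 / 4"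
      and t: "t \<le> Suc i * B"
    for V :: "'a set" and I :: "'b set" and e w \<kappa> h B t
  proof -
    interpret nibble V I e w r \<kappa> h by fact
    define t0 u where "t0 = min t (i * B)" and "u = t - t0"
    have t_eq: "t = t0 + u" and u: "u \<le> B" using t by (auto simp: t0_def u_def)
    have start: "accurate M t0 (1 / 4 ^ M)"
      using IH[OF nib _ B] small \<theta>' by (auto simp: t0_def)
    have "\<kappa> + h \<le> 1 / 4 ^ M / (real (r * (M + 1)) ^ 2 + 1)" using small by (simp add: \<theta>'_def)
    then have "(real (r * (M + 1)) ^ 2 + 1) * (\<kappa> + h) \<le> 1 / 4 ^ M"
      by (subst (asm) pos_le_divide_eq) (auto simp: add_nonneg_pos mult.commute)
    then have "(real (r * (M + 1)))\<^sup>2 * (\<kappa> + h) \<le> 1 / 4 ^ M"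
      using h_pos \<kappa>_nonneg by (simp add: distrib_right)
    from accurate_block[OF start this M(1), of u]
    have "accurate J t (4 ^ J / 4 ^ M * (1 + 4 * h * real (r * (M + 1))) ^ u)"
      by (simp only: t_eq)
    moreover have "4 ^ J / 4 ^ M * (1 + 4 * h * real (r * (M + 1))) ^ u \<le> \<epsilon>"
    proof -
      have "h * real r * real u \<le> h * real r * real B"
        using u h_pos by (intro mult_left_mono) auto
      then have "4 ^ J / 4 ^ M * (1 + 4 * h * real (r * (M + 1))) ^ u \<le> 4 ^ J / 4 ^ M * 3 ^ (M + 1)"
        using B by (intro mult_left_mono growth_bound) auto
      also have "\<dots> = 3 * 4 ^ J * (3 / 4) ^ M" by (simp add: power_divide)
      finally show ?thesis using M by simp
    qed
    ultimately show ?thesis by (rule accurate_mono)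
  qed
  with \<theta>'(1) show ?case by blast
qed

text \<open>
  The asymptotic equality of fractional and integral matching numbers under small codegrees, which goes
  back to Frankl and Roedl, Pippenger, and Kahn.
\<close>

theorem fractional_to_integral_matching:
  fixes r :: nat and \<epsilon> :: real
  assumes "0 < r" "0 < \<epsilon>"
  obtains \<kappa> where "\<kappa> > 0"
    "\<And>(V::'a set) (I::'b set) e w.
      finite V \<Longrightarrow> finite I \<Longrightarrow> (\<And>c. c \<in> I \<Longrightarrow> e c \<subseteq> V \<and> card (e c) = r) \<Longrightarrow>
      (\<And>c. c \<in> I \<Longrightarrow> 0 \<le> w c) \<Longrightarrow>
      (\<And>f. f \<in> V \<Longrightarrow> (\<Sum>c | c \<in> I \<and> f \<in> e c. w c) \<le> 1) \<Longrightarrow>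
      (\<And>f g. f \<in> V \<Longrightarrow> g \<in> V \<Longrightarrow> f \<noteq> g \<Longrightarrow>
        (\<Sum>c | c \<in> I \<and> f \<in> e c \<and> g \<in> e c. w c) \<le> \<kappa>) \<Longrightarrow>
      \<exists>M\<subseteq>I. pairwise (\<lambda>c d. disjnt (e c) (e d)) M \<and>
        real (card M) \<ge> sum w I - \<epsilon> * real (card V)"
proof -
  define d where "d = \<epsilon> / 2"
  have d: "0 < d" using assms by (simp add: d_def)
  \<comment> \<open>The process has to run for time \<open>h t \<ge> 1 / d ^ r\<close> to bring \<open>\<rho>\<close>
    below \<open>d\<close>; each of the \<open>i\<close> blocks lasts time \<open>1 / (4 r)\<close>.\<close>
  obtain i :: nat where i: "4 * real r / d ^ r \<le> real i" using real_arch_simple by blast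
  define a where "a = d / (real i / (4 * real r) + 1)"
  have a: "0 < a" using d assms by (simp add: a_def divide_pos_pos add_nonneg_pos)
  obtain \<theta> where \<theta>: "\<theta> > 0" and accurate: "\<And>(V::'a set) (I::'b set) e w \<kappa> h B t.
    nibble V I e w r \<kappa> h \<Longrightarrow> \<kappa> + h \<le> \<theta> \<Longrightarrow> h * real r * real B \<le> 1 / 4 \<Longrightarrow> t \<le> i * B \<Longrightarrow>
    nibble.accurate V I e w r h 0 t a"
    using accurate_uniformly[OF a, of r i 0] by metis
  show ?thesis
  proof (rule that[of "\<theta> / 2"])
    fix V :: "'a set" and I :: "'b set" and e w
    assume fin: "finite V" "finite I" and edge: "\<And>c. c \<in> I \<Longrightarrow> e c \<subseteq> V \<and> card (e c) = r"
      and w: "\<And>c. c \<in> I \<Longrightarrow> 0 \<le> w c"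
      and deg: "\<And>f. f \<in> V \<Longrightarrow> (\<Sum>c | c \<in> I \<and> f \<in> e c. w c) \<le> 1"
      and codeg: "\<And>f g. f \<in> V \<Longrightarrow> g \<in> V \<Longrightarrow> f \<noteq> g \<Longrightarrow>
        (\<Sum>c | c \<in> I \<and> f \<in> e c \<and> g \<in> e c. w c) \<le> \<theta> / 2"
    \<comment> \<open>A long block means a short time step, which is free to choose: it makes \<open>h\<close>
      negligible next to \<open>\<theta>\<close>.\<close>
    obtain B :: nat where B: "1 + real (card V) + 2 / \<theta> \<le> real B" using real_arch_simple by blast
    have Bpos: "0 < real B" using B \<theta> divide_pos_pos[of 2 \<theta>] by linarith
    define h where "h = 1 / (4 * real r * real B)"
    have r1: "1 \<le> real r" using assms by simp
    have h: "0 < h" using Bpos r1 by (simp add: h_def)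
    have hB: "h * real B = 1 / (4 * real r)" using Bpos by (simp add: h_def)
    have hB1: "h * real B \<le> 1" unfolding hB using r1 by (simp add: divide_le_eq)
    have h_mult: "h * y \<le> 1" if "y \<le> real B" for y
      using mult_left_mono[OF that, of h] h hB1 by linarith
    have card_le: "1 \<le> real B" "real (card V) \<le> real B" "2 / \<theta> \<le> real B"
      using B \<theta> divide_pos_pos[of 2 \<theta>] by linarith+
    have "h * (2 / \<theta>) \<le> 1" by (rule h_mult) (rule card_le)
    then have h\<theta>: "h \<le> \<theta> / 2" using \<theta> by (simp add: field_simps)
    have nib: "nibble V I e w r (\<theta> / 2) h"
      by unfold_locales
        (use fin edge w deg codeg assms h \<theta> h_mult[OF card_le(1)] h_mult[OF card_le(2)] in auto)
    interpret nibble V I e w r "\<theta> / 2" h by fact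
    have "accurate 0 t a" if "t < i * B" for t
    proof (rule accurate[OF nib, of B])
      have "h * real r * real B = 1 / 4" using Bpos r1 by (simp add: h_def)
      then show "h * real r * real B \<le> 1 / 4" by simp
    qed (use that h\<theta> in auto)
    from matching_exists[OF this, of "i * B"] a
    obtain M where M: "M \<subseteq> I" "pairwise (\<lambda>c d. disjnt (e c) (e d)) M"
      "real (card M) \<ge> sum w I - real (card V) * (\<rho> (i * B) + h * real (i * B) * a)" by auto
    have time: "h * real (i * B) = real i / (4 * real r)"
      using Bpos r1 by (simp add: h_def)
    have "\<rho> (i * B) \<le> d"
    proof (rule \<rho>_small[OF d])
      show "1 \<le> h * real (i * B) * d ^ r"
        unfolding time using i r1 d by (simp add: field_simps)
    qed
    moreover have "h * real (i * B) * a \<le> d"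
    proof -
      have "0 < real i / (4 * real r) + 1" using r1 by (simp add: add_nonneg_pos)
      moreover have "real i / (4 * real r) * d \<le> d * (real i / (4 * real r) + 1)"
        using d by (simp add: algebra_simps)
      ultimately show ?thesis
        unfolding time a_def times_divide_eq_right by (simp only: pos_divide_le_eq)
    qed
    ultimately have "real (card V) * (\<rho> (i * B) + h * real (i * B) * a) \<le> real (card V) * \<epsilon>"
      by (intro mult_left_mono) (auto simp: d_def)
    with M show "\<exists>M\<subseteq>I. pairwise (\<lambda>c d. disjnt (e c) (e d)) M \<and>
        real (card M) \<ge> sum w I - \<epsilon> * real (card V)"
      by (intro exI[of _ M]) (auto simp: mult.commute)
  qed (use \<theta> in simp)
qed

section \<open>Weights for a root of given degree\<close>

lemma pow_div_fact_nonneg: "0 \<le> x \<Longrightarrow> 0 \<le> pow_div_fact x m"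
  by (simp add: pow_div_fact_def)

lemma pow_div_fact_of_nat: "pow_div_fact x (int m) = x ^ m / fact m"
  by (simp add: pow_div_fact_def)

lemma pow_div_fact_diff:
  "pow_div_fact x (int i - int a) = (if a \<le> i then x ^ (i - a) / fact (i - a) else 0)"
  by (auto simp: pow_div_fact_def of_nat_diff[symmetric] simp del: of_nat_diff)

lemma pow_div_fact_mono: "0 \<le> x \<Longrightarrow> x \<le> y \<Longrightarrow> pow_div_fact x m \<le> pow_div_fact y m"
  by (cases m) (auto simp: pow_div_fact_def power_mono divide_right_mono)

lemma pow_div_fact_scale: "pow_div_fact (real n * x) (int i - int a) =
    real n ^ (i - a) * pow_div_fact x (int i - int a)"
  by (simp add: pow_div_fact_diff power_mult_distrib)

text \<open>
  The identity behind the double counting in \<open>type_sum_rec\<close>, valid for all integers thanks to the convention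
  for negative exponents.
\<close>

lemma pow_div_fact_rec: "x * pow_div_fact x (m - 1) = of_int m * pow_div_fact x m"
proof (cases "m \<ge> 1")
  case True
  define l where "l = nat (m - 1)"
  have l: "m = int (Suc l)" using True by (simp add: l_def)
  have "int (Suc l) - 1 = int l" by simp
  then show ?thesis unfolding l pow_div_fact_of_nat by (simp add: pow_div_fact_of_nat)
next
  case False
  then have "m < 0 \<or> m = 0" by auto
  then show ?thesis by (auto simp: pow_div_fact_def)
qed

text \<open>
  Up to a power of \<open>n\<close> and lower order terms, the total weight of the copies rooted at a vertex of blue degree \<open>x n\<close> that contain \<open>a\<close>
  prescribed blue and \<open>b\<close> prescribed red neighbours of the root. The three equations of the linear system
  are the cases \<open>(2, 0)\<close>, \<open>(0, 2)\<close> and \<open>(1, 1)\<close>.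
\<close>

definition type_sum :: "nat \<Rightarrow> real \<Rightarrow> (nat \<Rightarrow> real) \<Rightarrow> nat \<Rightarrow> nat \<Rightarrow> real"
  where "type_sum k x p a b = (\<Sum>i<k. pow_div_fact x (int i - int a) *
    pow_div_fact (1 - x) (int (k - 1 - i) - int b) * p i)"

lemma type_sum_blue:
  "x * type_sum k x p (Suc a) b = (\<Sum>i<k. (real i - real a) * (pow_div_fact x (int i - int a) *
    pow_div_fact (1 - x) (int (k - 1 - i) - int b) * p i))"
proof -
  have "x * pow_div_fact x (int i - int (Suc a)) = (real i - real a) * pow_div_fact x (int i - int a)"
    for i using pow_div_fact_rec[of x "int i - int a"] by (simp add: algebra_simps)
  then show ?thesis
    unfolding type_sum_def sum_distrib_left by (intro sum.cong) (auto simp: mult.assoc[symmetric])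
qed

lemma type_sum_red:
  "(1 - x) * type_sum k x p a (Suc b) = (\<Sum>i<k. (real (k - 1 - i) - real b) *
    (pow_div_fact x (int i - int a) * pow_div_fact (1 - x) (int (k - 1 - i) - int b) * p i))"
proof -
  have rec: "(1 - x) * pow_div_fact (1 - x) (int l - int (Suc b)) =
    (real l - real b) * pow_div_fact (1 - x) (int l - int b)"
    for l using pow_div_fact_rec[of "1 - x" "int l - int b"] by (simp add: algebra_simps)
  have "(1 - x) * (u * pow_div_fact (1 - x) (int l - int (Suc b)) * y) =
    (real l - real b) * (u * pow_div_fact (1 - x) (int l - int b) * y)" for u y l
  proof -
    have "(1 - x) * (u * pow_div_fact (1 - x) (int l - int (Suc b)) * y) =
      u * y * ((1 - x) * pow_div_fact (1 - x) (int l - int (Suc b)))" by (simp only: ac_simps)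
    also have "\<dots> = (real l - real b) * (u * pow_div_fact (1 - x) (int l - int b) * y)"
      by (simp only: rec ac_simps)
    finally show ?thesis .
  qed
  then show ?thesis
    unfolding type_sum_def sum_distrib_left by (simp only: cong: sum.cong)
qed

text \<open>
  Choosing one more of the \<open>k - 1 - a - b\<close> remaining vertices of the copy, which is blue or red.
\<close>

lemma type_sum_rec:
  "(real k - 1 - real a - real b) * type_sum k x p a b =
    x * type_sum k x p (Suc a) b + (1 - x) * type_sum k x p a (Suc b)"
proof -
  let ?t = "\<lambda>i. pow_div_fact x (int i - int a) * pow_div_fact (1 - x) (int (k - 1 - i) - int b) * p i"
  have "x * type_sum k x p (Suc a) b + (1 - x) * type_sum k x p a (Suc b)
    = (\<Sum>i<k. (real i - real a) * ?t i + (real (k - 1 - i) - real b) * ?t i)"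
    unfolding type_sum_blue type_sum_red by (rule sum.distrib[symmetric])
  also have "\<dots> = (\<Sum>i<k. (real k - 1 - real a - real b) * ?t i)"
  proof (rule sum.cong)
    fix i assume "i \<in> {..<k}"
    then have "real (k - 1 - i) = real k - 1 - real i" by (simp add: of_nat_diff)
    then show "(real i - real a) * ?t i + (real (k - 1 - i) - real b) * ?t i
      = (real k - 1 - real a - real b) * ?t i" by (simp add: algebra_simps)
  qed simp
  finally show ?thesis by (simp add: type_sum_def sum_distrib_left)
qed

text \<open>
  The linear system for the parameter \<open>x\<close>, with degrees in \<open>S\<close> to be given the value \<open>0\<close>.
\<close>

definition balanced :: "nat \<Rightarrow> real \<Rightarrow> (nat \<Rightarrow> real) \<Rightarrow> bool"
  where "balanced k x p \<longleftrightarrow> (\<forall>i. 0 \<le> p i) \<and>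
    type_sum k x p 2 0 = 1 \<and> type_sum k x p 1 1 = 1 \<and> type_sum k x p 0 2 = 1"

lemma balanced_sums:
  assumes "balanced k x p" "k \<ge> 3"
  shows "type_sum k x p 1 0 = 1 / (real k - 2)" "type_sum k x p 0 1 = 1 / (real k - 2)"
    "type_sum k x p 0 0 = 1 / ((real k - 1) * (real k - 2))"
proof -
  have k: "real k - 2 > 0" "real k - 1 > 0" using assms by auto
  have eq: "type_sum k x p (Suc (Suc 0)) 0 = 1" "type_sum k x p (Suc 0) (Suc 0) = 1"
    "type_sum k x p 0 (Suc (Suc 0)) = 1"
    using assms by (auto simp: balanced_def numeral_2_eq_2)
  have "(real k - 2) * type_sum k x p 1 0 = 1" "(real k - 2) * type_sum k x p 0 1 = 1"
    using type_sum_rec[of k 1 0 x p] type_sum_rec[of k 0 1 x p] by (simp_all add: eq)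
  with k show 1: "type_sum k x p 1 0 = 1 / (real k - 2)" "type_sum k x p 0 1 = 1 / (real k - 2)"
    by (simp_all add: field_simps)
  have "(real k - 1) * type_sum k x p 0 0 = x / (real k - 2) + (1 - x) / (real k - 2)"
    using type_sum_rec[of k 0 0 x p] 1 by simp
  also have "\<dots> = 1 / (real k - 2)" by (simp add: add_divide_distrib[symmetric])
  finally show "type_sum k x p 0 0 = 1 / ((real k - 1) * (real k - 2))"
    using k by (simp only: eq_divide_eq) (simp add: ac_simps)
qed

text \<open>
  The numbers summed in \<open>type_sum k x p 0 0\<close> form, after normalisation, a probability distribution of the root
  degree with mean \<open>(k - 1) x\<close>. A mean below \<open>1\<close> forces an atom at \<open>0\<close>.
\<close>

lemma balanced_imp_isolated:
  assumes "balanced k x p" "k \<ge> 3" "0 < x" "x < 1 / (real k - 1)"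
  shows "p 0 \<noteq> 0"
proof
  assume p0: "p 0 = 0"
  let ?t = "\<lambda>i. pow_div_fact x (int i - int 0) * pow_div_fact (1 - x) (int (k - 1 - i) - int 0) * p i"
  have k: "real k - 2 > 0" "real k - 1 > 0" using assms by auto
  have "1 / (real k - 1) \<le> 1" using assms by (simp add: field_simps)
  then have x1: "0 \<le> 1 - x" using assms by linarith
  have "type_sum k x p 0 0 \<le> x * type_sum k x p (Suc 0) 0"
    unfolding type_sum_blue unfolding type_sum_def
  proof (rule sum_mono)
    fix i
    have "0 \<le> ?t i" using assms x1 by (auto simp: balanced_def intro!: mult_nonneg_nonneg pow_div_fact_nonneg)
    then show "?t i \<le> (real i - real 0) * ?t i"
      using p0 mult_right_mono[of 1 "real i" "?t i"] by (cases i) auto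
  qed
  then have "1 / ((real k - 1) * (real k - 2)) \<le> x / (real k - 2)"
    using balanced_sums[OF assms(1,2)] by simp
  then have "1 / (real k - 1) / (real k - 2) \<le> x / (real k - 2)" by (simp only: divide_divide_eq_left)
  then have "1 / (real k - 1) \<le> x" using k by (simp only: divide_le_cancel)
  then show False using assms by simp
qed

lemma balanced_imp_dominating:
  assumes "balanced k x p" "k \<ge> 3" "x < 1" "1 - x < 1 / (real k - 1)"
  shows "p (k - 1) \<noteq> 0"
proof
  assume p0: "p (k - 1) = 0"
  let ?t = "\<lambda>i. pow_div_fact x (int i - int 0) * pow_div_fact (1 - x) (int (k - 1 - i) - int 0) * p i"
  have k: "real k - 2 > 0" "real k - 1 > 0" using assms by auto
  have "1 / (real k - 1) \<le> 1" using assms by (simp add: field_simps)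
  then have x1: "0 \<le> x" using assms by linarith
  have "type_sum k x p 0 0 \<le> (1 - x) * type_sum k x p 0 (Suc 0)"
    unfolding type_sum_red unfolding type_sum_def
  proof (rule sum_mono)
    fix i assume "i \<in> {..<k}"
    then have i: "i = k - 1 \<or> 1 \<le> real (k - 1 - i)" by auto
    have "0 \<le> ?t i" using assms x1 by (auto simp: balanced_def intro!: mult_nonneg_nonneg pow_div_fact_nonneg)
    then show "?t i \<le> (real (k - 1 - i) - real 0) * ?t i"
      using p0 i mult_right_mono[of 1 "real (k - 1 - i)" "?t i"] by auto
  qed
  then have "1 / ((real k - 1) * (real k - 2)) \<le> (1 - x) / (real k - 2)"
    using balanced_sums[OF assms(1,2)] by simp
  then have "1 / (real k - 1) / (real k - 2) \<le> (1 - x) / (real k - 2)" by (simp only: divide_divide_eq_left)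
  then have "1 / (real k - 1) \<le> 1 - x" using k by (simp only: divide_le_cancel)
  then show False using assms by simp
qed

text \<open>
  A relaxation of \<open>balanced\<close> with bounded weights: no pair of neighbours is overloaded, and at most a
  small part of the total weight, which is \<open>1 / ((k - 1) (k - 2))\<close> in the balanced case, is lost.
\<close>

definition root_weight :: "nat \<Rightarrow> real \<Rightarrow> real \<Rightarrow> real \<Rightarrow> (nat \<Rightarrow> real) \<Rightarrow> bool"
  where "root_weight k d C x p \<longleftrightarrow> (\<forall>i. 0 \<le> p i \<and> p i \<le> C) \<and>
    type_sum k x p 2 0 \<le> 1 \<and> type_sum k x p 1 1 \<le> 1 \<and> type_sum k x p 0 2 \<le> 1 \<and>
    type_sum k x p 0 0 \<ge> (1 - d) ^ (k - 1) / ((real k - 1) * (real k - 2))"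

lemma root_weight_pair_le:
  assumes rw: "root_weight k d C x p" and x: "0 \<le> x" "x \<le> 1" and k: "k \<ge> 3"
  shows "a + b = 2 \<Longrightarrow> type_sum k x p a b \<le> 1"
    and "a + b = 1 \<Longrightarrow> type_sum k x p a b \<le> 1 / (real k - 2)"
proof -
  have two: "type_sum k x p a b \<le> 1" if "a + b = 2" for a b
  proof -
    have "(a = 2 \<and> b = 0) \<or> (a = 1 \<and> b = 1) \<or> (a = 0 \<and> b = 2)" using that by linarith
    then show ?thesis using rw by (auto simp: root_weight_def)
  qed
  then show "a + b = 2 \<Longrightarrow> type_sum k x p a b \<le> 1" .
  assume ab: "a + b = 1"
  have "(real k - 1 - real a - real b) * type_sum k x p a b =
      x * type_sum k x p (Suc a) b + (1 - x) * type_sum k x p a (Suc b)"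
    by (rule type_sum_rec)
  also have "\<dots> \<le> x * 1 + (1 - x) * 1"
    using ab x by (intro add_mono mult_left_mono two) auto
  also have "real k - 1 - real a - real b = real k - 2" using ab by linarith
  finally show "type_sum k x p a b \<le> 1 / (real k - 2)"
    using k by (simp add: field_simps)
qed

lemma fact_two_below:
  assumes "k \<ge> 3"
  shows "(fact (k - 1) :: real) = (real k - 1) * (real k - 2) * fact (k - 3)"
proof -
  define l where "l = k - 3"
  have "k = Suc (Suc (Suc l))" using assms by (simp add: l_def)
  then show ?thesis by (simp add: algebra_simps)
qed

lemma type_sum_single:
  assumes "j < k"
  shows "type_sum k x (\<lambda>i. if i = j then y else 0) a b =
    pow_div_fact x (int j - int a) * pow_div_fact (1 - x) (int (k - 1 - j) - int b) * y"
proof -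
  have "type_sum k x (\<lambda>i. if i = j then y else 0) a b = (\<Sum>i<k. if i = j then
      pow_div_fact x (int j - int a) * pow_div_fact (1 - x) (int (k - 1 - j) - int b) * y else 0)"
    unfolding type_sum_def by (intro sum.cong) auto
  then show ?thesis using assms by simp
qed

text \<open>
  For small \<open>x\<close> almost all pairs of neighbours are red, and copies in which the root is isolated cover these.
\<close>

lemma root_weight_isolated:
  assumes "k \<ge> 3" "0 \<le> x" "x \<le> d" "d < 1" "fact (k - 3) \<le> C"
  shows "root_weight k d C x (\<lambda>i. if i = 0 then fact (k - 3) else 0)"
proof -
  have k0: "0 < k" using assms by simp
  note ts = type_sum_single[OF k0]
  have "(1 - x) ^ (k - 3) \<le> 1" using assms by (intro power_le_one) auto
  moreover have "k - 1 - 2 = k - 3" by simp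
  ultimately have 1: "type_sum k x (\<lambda>i. if i = 0 then fact (k - 3) else 0) 0 2 \<le> 1"
    using assms by (simp only: ts pow_div_fact_diff) auto
  have "(1 - d) ^ (k - 1) \<le> (1 - x) ^ (k - 1)" using assms by (intro power_mono) auto
  then have "(1 - d) ^ (k - 1) / ((real k - 1) * (real k - 2)) \<le>
      (1 - x) ^ (k - 1) / ((real k - 1) * (real k - 2))"
    using assms by (intro divide_right_mono) auto
  also have "\<dots> = (1 - x) ^ (k - 1) / fact (k - 1) * fact (k - 3)"
    unfolding fact_two_below[OF assms(1)] by simp
  finally have 2: "type_sum k x (\<lambda>i. if i = 0 then fact (k - 3) else 0) 0 0
      \<ge> (1 - d) ^ (k - 1) / ((real k - 1) * (real k - 2))"
    unfolding ts pow_div_fact_diff by simp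
  show ?thesis unfolding root_weight_def
  proof (intro conjI 1 2)
    have "(0::real) \<le> C" using assms(5) by (rule order.trans[rotated]) simp
    then show "\<forall>i. 0 \<le> (if i = 0 then fact (k - 3) else (0 :: real)) \<and> (if i = 0 then fact (k - 3) else 0) \<le> C"
      using assms by simp
  qed (simp_all only: ts pow_div_fact_diff, simp_all)
qed

text \<open>
  Exchanging the colours.
\<close>

lemma type_sum_flip:
  assumes "\<And>i. i < k \<Longrightarrow> q i = p (k - 1 - i)"
  shows "type_sum k x q a b = type_sum k (1 - x) p b a"
proof -
  have "type_sum k x q a b = (\<Sum>i<k. pow_div_fact x (int i - int a) *
    pow_div_fact (1 - x) (int (k - 1 - i) - int b) * p (k - 1 - i))"
    unfolding type_sum_def by (intro sum.cong) (simp_all add: assms)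
  also have "\<dots> = (\<Sum>i<k. pow_div_fact x (int (k - 1 - i) - int a) *
    pow_div_fact (1 - x) (int i - int b) * p i)"
    by (rule sum.reindex_bij_witness[of _ "\<lambda>i. k - 1 - i" "\<lambda>i. k - 1 - i"]) auto
  finally show ?thesis by (simp add: type_sum_def mult.commute)
qed

lemma root_weight_flip:
  assumes "root_weight k d C (1 - x) p" "\<And>i. 0 \<le> q i \<and> q i \<le> C" "\<And>i. i < k \<Longrightarrow> q i = p (k - 1 - i)"
  shows "root_weight k d C x q"
  using assms(1,2) type_sum_flip[of k q p x, OF assms(3)] by (simp add: root_weight_def)

text \<open>
  The total of all terms is fixed, so a single \<open>p i\<close> can be large only if its coefficient is
  small, and this is excluded for \<open>x\<close> away from \<open>0\<close> and \<open>1\<close>.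
\<close>

lemma balanced_root_weight:
  assumes bal: "balanced k x p" and supp: "\<And>i. i \<ge> k \<Longrightarrow> p i = 0" and "k \<ge> 3"
    and "0 < d" "d \<le> x" "x \<le> 1 - d"
  shows "root_weight k d ((fact (k - 1))\<^sup>2 / d ^ (k - 1)) x p"
proof -
  have k: "real k - 2 > 0" "real k - 1 > 0" using assms by auto
  have p0: "0 \<le> p i" for i using bal by (simp add: balanced_def)
  let ?t = "\<lambda>i. pow_div_fact x (int i - int 0) * pow_div_fact (1 - x) (int (k - 1 - i) - int 0) * p i"
  have "p i \<le> (fact (k - 1))\<^sup>2 / d ^ (k - 1)" for i
  proof (cases "i < k")
    case True
    have "?t i \<le> type_sum k x p 0 0"
      unfolding type_sum_def using True assms p0
      by (intro member_le_sum) (auto intro!: mult_nonneg_nonneg pow_div_fact_nonneg)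
    also have "\<dots> = 1 / ((real k - 1) * (real k - 2))" by (rule balanced_sums[OF bal \<open>k \<ge> 3\<close>])
    also have "\<dots> \<le> 1"
      using assms mult_mono[of 1 "real k - 1" 1 "real k - 2"] by (simp add: divide_le_eq)
    finally have "x ^ i * (1 - x) ^ (k - 1 - i) * p i \<le> fact i * fact (k - 1 - i)"
      by (simp only: pow_div_fact_diff) (simp add: field_simps)
    also have "\<dots> \<le> (fact (k - 1))\<^sup>2"
      unfolding power2_eq_square using True by (intro mult_mono fact_mono) auto
    finally have "x ^ i * (1 - x) ^ (k - 1 - i) * p i \<le> (fact (k - 1))\<^sup>2" .
    moreover have "d ^ i * d ^ (k - 1 - i) * p i \<le> x ^ i * (1 - x) ^ (k - 1 - i) * p i"
      using assms p0 by (intro mult_right_mono mult_mono power_mono) auto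
    moreover have "d ^ i * d ^ (k - 1 - i) = d ^ (k - 1)"
      using True by (simp add: power_add[symmetric])
    ultimately show ?thesis using assms by (simp add: field_simps)
  next
    case False
    then show ?thesis using supp[of i] assms by simp
  qed
  moreover have "(1 - d) ^ (k - 1) / ((real k - 1) * (real k - 2)) \<le> 1 / ((real k - 1) * (real k - 2))"
    using k assms by (intro divide_right_mono power_le_one) auto
  ultimately show ?thesis
    using p0 bal balanced_sums[OF bal \<open>k \<ge> 3\<close>] by (simp add: root_weight_def balanced_def)
qed

text \<open>
  The bound on the weights depends on \<open>d\<close> but not on \<open>x\<close>, so the weights may be chosen for each vertex
  separately.
\<close>

lemma root_weight_exists:
  fixes d :: real
  assumes k: "k \<ge> 3" and d: "0 < d" "d \<le> 1 / 2"
    and sol: "\<And>x. 0 < x \<Longrightarrow> x < 1 \<Longrightarrow> \<exists>p. balanced k x p \<and> (\<forall>i. i \<notin> T \<longrightarrow> p i = 0)"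
    and T: "T \<subseteq> {..<k}" and x: "0 \<le> x" "x \<le> 1"
  shows "\<exists>p. root_weight k d ((fact (k - 1))\<^sup>2 / d ^ (k - 1)) x p \<and> (\<forall>i. i \<notin> T \<longrightarrow> p i = 0)"
proof -
  let ?C = "(fact (k - 1))\<^sup>2 / d ^ (k - 1)"
  have "(fact (k - 3) :: real) \<le> fact (k - 1) * fact (k - 1)"
  proof -
    have "(fact (k - 3) :: real) * 1 \<le> fact (k - 1) * fact (k - 1)"
      by (intro mult_mono fact_mono) auto
    then show ?thesis by simp
  qed
  also have "\<dots> \<le> ?C"
    using d power_le_one[of d "k - 1"] by (simp add: power2_eq_square le_divide_eq mult_left_le)
  finally have C: "fact (k - 3) \<le> ?C" .
  have small: "1 / real k < 1 / (real k - 1)" "0 < 1 / real k" "1 / real k < 1"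
    using k by (auto simp: field_simps)
  obtain p where "balanced k (1 / real k) p" "\<forall>i. i \<notin> T \<longrightarrow> p i = 0"
    using sol small by blast
  then have T0: "0 \<in> T" using balanced_imp_isolated[of k "1 / real k" p] small k by auto
  obtain p where "balanced k (1 - 1 / real k) p" "\<forall>i. i \<notin> T \<longrightarrow> p i = 0"
    using sol[of "1 - 1 / real k"] small by auto
  then have T1: "k - 1 \<in> T" using balanced_imp_dominating[of k "1 - 1 / real k" p] small k by auto
  let ?q = "\<lambda>i. if i = 0 then fact (k - 3) else (0 :: real)"
  consider "x < d" | "1 - x < d" | "d \<le> x" "x \<le> 1 - d" by linarith
  then show ?thesis
  proof cases
    case 1
    then have "root_weight k d ?C x ?q"
      using root_weight_isolated[OF k, of x d ?C] C d x by simp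
    then show ?thesis using T0 by (intro exI[of _ ?q]) auto
  next
    case 2
    then have "root_weight k d ?C (1 - x) ?q"
      using root_weight_isolated[OF k, of "1 - x" d ?C] C d x by simp
    then have "root_weight k d ?C x (\<lambda>i. if i = k - 1 then fact (k - 3) else 0)"
    proof (rule root_weight_flip)
      have "0 \<le> ?C" using d by simp
      then show "0 \<le> (if i = k - 1 then fact (k - 3) else (0 :: real)) \<and> (if i = k - 1 then fact (k - 3) else 0) \<le> ?C"
        for i using C by simp
    qed auto
    then show ?thesis using T1 by (intro exI[of _ "\<lambda>i. if i = k - 1 then fact (k - 3) else 0"]) auto
  next
    case 3
    then have "0 < x" "x < 1" using d by auto
    from sol[OF this] obtain p where p: "balanced k x p" "\<forall>i. i \<notin> T \<longrightarrow> p i = 0" by blast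
    have "root_weight k d ?C x p"
      by (rule balanced_root_weight[OF p(1) _ k]) (use p(2) T 3 d in auto)
    then show ?thesis using p(2) by blast
  qed
qed

section \<open>Counting copies through a root\<close>

lemma card_subsets_split:
  assumes "finite A" "finite B" "A \<inter> B = {}" "\<A> \<subseteq> Pow A" "\<B> \<subseteq> Pow B"
  shows "card {K. K \<subseteq> A \<union> B \<and> K \<inter> A \<in> \<A> \<and> K \<inter> B \<in> \<B>} = card \<A> * card \<B>"
proof -
  have "bij_betw (\<lambda>(C, D). C \<union> D) (\<A> \<times> \<B>) {K. K \<subseteq> A \<union> B \<and> K \<inter> A \<in> \<A> \<and> K \<inter> B \<in> \<B>}"
  proof (rule bij_betwI[where g = "\<lambda>K. (K \<inter> A, K \<inter> B)"])
    have inter: "(C \<union> D) \<inter> A = C" "(C \<union> D) \<inter> B = D" if "C \<in> \<A>" "D \<in> \<B>" for C D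
      using that assms(3-5) by blast+
    show "(\<lambda>(C, D). C \<union> D) \<in> \<A> \<times> \<B> \<rightarrow> {K. K \<subseteq> A \<union> B \<and> K \<inter> A \<in> \<A> \<and> K \<inter> B \<in> \<B>}"
      using inter assms(4,5) by auto
    show "(\<lambda>K. (K \<inter> A, K \<inter> B)) ((\<lambda>(C, D). C \<union> D) z) = z" if "z \<in> \<A> \<times> \<B>" for z
      using that inter by (cases z) auto
  qed auto
  then show ?thesis by (simp add: bij_betw_same_card[symmetric] card_cartesian_product)
qed

lemma card_supersets_le:
  assumes "finite A" "P \<subseteq> A"
  shows "real (card {C. C \<subseteq> A \<and> P \<subseteq> C \<and> card C = i}) \<le> pow_div_fact (card A) (int i - int (card P))"
proof (cases "card P \<le> i")
  case True
  have finP: "finite P" using assms finite_subset by blast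
  have "card {C. C \<subseteq> A \<and> P \<subseteq> C \<and> card C = i} \<le> card {C. C \<subseteq> A \<and> card C = i - card P}"
  proof (rule card_inj_on_le[where f = "\<lambda>C. C - P"])
    show "inj_on (\<lambda>C. C - P) {C. C \<subseteq> A \<and> P \<subseteq> C \<and> card C = i}"
      by (auto simp: inj_on_def)
    show "(\<lambda>C. C - P) ` {C. C \<subseteq> A \<and> P \<subseteq> C \<and> card C = i} \<subseteq> {C. C \<subseteq> A \<and> card C = i - card P}"
      using finP by (auto simp: card_Diff_subset)
  qed (use assms in auto)
  also have "\<dots> = card A choose (i - card P)" using assms by (simp add: n_subsets)
  finally have "real (card {C. C \<subseteq> A \<and> P \<subseteq> C \<and> card C = i}) * fact (i - card P)
      \<le> real ((card A choose (i - card P)) * fact (i - card P))"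
    by (simp add: mult_right_mono)
  also have "\<dots> \<le> real (card A ^ (i - card P))"
    unfolding of_nat_le_iff by (rule binomial_fact_pow)
  finally show ?thesis using True unfolding pow_div_fact_diff by (simp add: le_divide_eq)
next
  case False
  have "{C. C \<subseteq> A \<and> P \<subseteq> C \<and> card C = i} = {}"
    using False assms card_mono finite_subset by (metis (mono_tags, lifting) empty_Collect_eq)
  then show ?thesis using False by (simp only: pow_div_fact_diff card.empty) simp
qed

text \<open>
  The falling factorial of \<open>m\<close> agrees with \<open>y ^ i\<close> up to lower order terms. The room between \<open>m\<close> and
  \<open>m + 1\<close> is used for the red neighbours: their number is \<open>n (1 - x) - 1\<close> because the root itself
  is not a neighbour.
\<close>

lemma binomial_lower:
  assumes "0 \<le> y" "y \<le> real m + 1" "y \<le> N" "real m \<le> N" "0 < N"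
  shows "y ^ i / fact i - real (m choose i) \<le> real (i * (i + 1)) * N ^ i / N"
proof -
  let ?f = "\<lambda>i. \<Prod>l=0..<i. real m - real l"
  have f: "?f i = fact i * real (m choose i)" for i
    by (simp add: binomial_gbinomial gbinomial_mult_fact)
  have f_le: "?f i \<le> N ^ i" for i
  proof -
    have "fact i * real (m choose i) \<le> real (m ^ i)"
    proof -
      have "real ((m choose i) * fact i) \<le> real (m ^ i)"
        unfolding of_nat_le_iff by (rule binomial_fact_pow)
      then show ?thesis by (simp add: mult.commute)
    qed
    also have "\<dots> \<le> N ^ i" using assms by (simp add: power_mono)
    finally show ?thesis by (simp only: f)
  qed
  have main: "(y ^ i - ?f i) * N \<le> real (i * (i + 1)) * N ^ i" for i
  proof (induction i)
    case (Suc i)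
    have f0: "0 \<le> ?f i" unfolding f by simp
    have "(y ^ Suc i - ?f (Suc i)) * N = ((y ^ i - ?f i) * N) * y + (?f i * N) * (y - real m + real i)"
      by (simp add: algebra_simps)
    also have "\<dots> \<le> (real (i * (i + 1)) * N ^ i) * N + (N ^ i * N) * (real i + 1)"
    proof (rule add_mono)
      have "((y ^ i - ?f i) * N) * y \<le> (real (i * (i + 1)) * N ^ i) * y"
        using Suc assms by (intro mult_right_mono) auto
      also have "\<dots> \<le> (real (i * (i + 1)) * N ^ i) * N"
        using assms by (intro mult_left_mono) auto
      finally show "((y ^ i - ?f i) * N) * y \<le> (real (i * (i + 1)) * N ^ i) * N" .
      have "(?f i * N) * (y - real m + real i) \<le> (?f i * N) * (real i + 1)"
        using assms f0 by (intro mult_left_mono) auto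
      also have "\<dots> \<le> (N ^ i * N) * (real i + 1)"
        using assms f_le by (intro mult_right_mono) auto
      finally show "(?f i * N) * (y - real m + real i) \<le> (N ^ i * N) * (real i + 1)" .
    qed
    also have "\<dots> = (real i + 1) * (real i + 1) * N ^ Suc i" by (simp add: algebra_simps)
    also have "\<dots> \<le> real (Suc i * (Suc i + 1)) * N ^ Suc i"
      using assms by (intro mult_right_mono) (auto simp: algebra_simps)
    finally show ?case .
  qed simp
  have "y ^ i / fact i - real (m choose i) = (y ^ i - ?f i) / fact i"
    unfolding f by (simp add: diff_divide_distrib)
  also have "\<dots> \<le> (real (i * (i + 1)) * N ^ i / N) / fact i"
    using main[of i] assms by (intro divide_right_mono) (auto simp: le_divide_eq)
  also have "\<dots> \<le> real (i * (i + 1)) * N ^ i / N"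
  proof -
    have "z / fact i \<le> z" if "0 \<le> z" for z :: real
      using that fact_ge_1[of i, where 'a = real] mult_left_mono[of 1 "fact i" z]
      by (simp add: divide_le_eq)
    then show ?thesis using assms by (meson divide_nonneg_pos mult_nonneg_nonneg of_nat_0_le_iff zero_le_power less_imp_le)
  qed
  finally show ?thesis .
qed

lemma binomial_product_lower:
  assumes "b + c + 1 = n" "i + j + 1 = k"
  shows "real (b choose i) * real (c choose j) \<ge>
    real b ^ i / fact i * ((real n - real b) ^ j / fact j) - 2 * real k ^ 2 * real n ^ (k - 1) / real n"
proof -
  define N where "N = real n"
  have N: "0 < N" "real b \<le> N" "real c \<le> N" "real n - real b = real c + 1"
    using assms by (auto simp: N_def)
  have B: "real b ^ i / fact i - real (b choose i) \<le> real (i * (i + 1)) * N ^ i / N"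
    using N by (intro binomial_lower) auto
  have C: "(real n - real b) ^ j / fact j - real (c choose j) \<le> real (j * (j + 1)) * N ^ j / N"
    using N assms by (intro binomial_lower) (auto simp: N_def)
  have c_le: "(real n - real b) ^ j / fact j \<le> N ^ j"
  proof -
    have "(real n - real b) ^ j \<le> N ^ j" using N by (intro power_mono) (auto simp: N_def)
    also have "\<dots> \<le> N ^ j * fact j" using N fact_ge_1[of j, where 'a = real] by simp
    finally show ?thesis by (simp add: divide_le_eq)
  qed
  have b_le: "real (b choose i) \<le> N ^ i"
  proof -
    have "b choose i \<le> b ^ i"
    proof -
      have "(b choose i) * 1 \<le> (b choose i) * fact i"
        using fact_ge_1[of i, where 'a = nat] by (rule mult_le_mono2)
      then show ?thesis using binomial_fact_pow[of b i] by linarith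
    qed
    then have "real (b choose i) \<le> real b ^ i" by (simp flip: of_nat_power)
    also have "\<dots> \<le> N ^ i" using N by (intro power_mono) auto
    finally show ?thesis .
  qed
  have "real b ^ i / fact i * ((real n - real b) ^ j / fact j) - real (b choose i) * real (c choose j)
    = (real b ^ i / fact i - real (b choose i)) * ((real n - real b) ^ j / fact j)
     + real (b choose i) * ((real n - real b) ^ j / fact j - real (c choose j))"
    by (simp add: algebra_simps)
  also have "\<dots> \<le> (real (i * (i + 1)) * N ^ i / N) * N ^ j + N ^ i * (real (j * (j + 1)) * N ^ j / N)"
  proof (rule add_mono)
    have "(real b ^ i / fact i - real (b choose i)) * ((real n - real b) ^ j / fact j)
      \<le> (real (i * (i + 1)) * N ^ i / N) * ((real n - real b) ^ j / fact j)"
      using B N by (intro mult_right_mono) auto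
    also have "\<dots> \<le> (real (i * (i + 1)) * N ^ i / N) * N ^ j"
      using c_le N by (intro mult_left_mono) auto
    finally show "(real b ^ i / fact i - real (b choose i)) * ((real n - real b) ^ j / fact j)
       \<le> (real (i * (i + 1)) * N ^ i / N) * N ^ j" .
    have "real (b choose i) * ((real n - real b) ^ j / fact j - real (c choose j))
      \<le> real (b choose i) * (real (j * (j + 1)) * N ^ j / N)"
      using C by (intro mult_left_mono) auto
    also have "\<dots> \<le> N ^ i * (real (j * (j + 1)) * N ^ j / N)"
      using b_le N by (intro mult_right_mono) auto
    finally show "real (b choose i) * ((real n - real b) ^ j / fact j - real (c choose j))
      \<le> N ^ i * (real (j * (j + 1)) * N ^ j / N)" .
  qed
  also have "\<dots> = real (i * (i + 1) + j * (j + 1)) * N ^ (i + j) / N"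
    by (simp add: power_add add_divide_distrib algebra_simps)
  also have "\<dots> \<le> 2 * real k ^ 2 * N ^ (i + j) / N"
  proof -
    have "i * (i + 1) \<le> k * k" "j * (j + 1) \<le> k * k" using assms by (intro mult_le_mono; simp)+
    then have "i * (i + 1) + j * (j + 1) \<le> 2 * (k * k)" by linarith
    then have "real (i * (i + 1) + j * (j + 1)) \<le> real (2 * (k * k))" unfolding of_nat_le_iff .
    then have "real (i * (i + 1) + j * (j + 1)) \<le> 2 * real k ^ 2" by (simp add: power2_eq_square)
    then show ?thesis using N by (intro divide_right_mono mult_right_mono) auto
  qed
  also have "i + j = k - 1" using assms by simp
  finally show ?thesis by (simp add: N_def)
qed

locale coloring =
  fixes V :: "'a set" and E :: "'a set set"
  assumes finite_V: "finite V" and E: "E \<in> colorings V"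
begin

definition blue :: "'a \<Rightarrow> 'a set"
  where "blue v = {u. {v, u} \<in> E}"

definition red :: "'a \<Rightarrow> 'a set"
  where "red v = V - {v} - blue v"

definition bdens :: "'a \<Rightarrow> real"
  where "bdens v = real (card (blue v)) / real (card V)"

lemma blue_subset: "blue v \<subseteq> V - {v}"
proof
  fix u assume "u \<in> blue v"
  then have "{v, u} \<subseteq> V" "card {v, u} = 2"
    using E by (auto simp: blue_def colorings_def nsets_def)
  then show "u \<in> V - {v}" by auto
qed

lemma finite_blue_red: "finite (blue v)" "finite (red v)"
  using finite_subset[OF blue_subset] finite_V by (auto simp: red_def)

lemma blue_red_split: "blue v \<union> red v = V - {v}" "blue v \<inter> red v = {}"
  using blue_subset by (auto simp: red_def)

lemma card_blue_red:
  assumes "v \<in> V"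
  shows "card (blue v) + card (red v) + 1 = card V"
proof -
  have "card (blue v) + card (red v) = card (V - {v})"
    unfolding blue_red_split(1)[symmetric]
    by (intro card_Un_disjoint[symmetric] finite_blue_red blue_red_split)
  moreover have "card V = Suc (card (V - {v}))" using assms finite_V by (rule card.remove[rotated])
  ultimately show ?thesis by simp
qed

lemma degree_induced:
  assumes "K \<subseteq> V" "v \<in> K"
  shows "degree (induced E K) v = card (K \<inter> blue v)"
proof -
  have "{e \<in> induced E K. v \<in> e} = (\<lambda>u. {v, u}) ` (K \<inter> blue v)"
  proof
    show "{e \<in> induced E K. v \<in> e} \<subseteq> (\<lambda>u. {v, u}) ` (K \<inter> blue v)"
    proof
      fix e assume "e \<in> {e \<in> induced E K. v \<in> e}"
      then have e: "e \<in> E" "v \<in> e" "e \<subseteq> K" "card e = 2"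
        by (auto simp: induced_def nsets_def)
      then obtain u where "e = {v, u}" by (auto simp: card_2_iff)
      then show "e \<in> (\<lambda>u. {v, u}) ` (K \<inter> blue v)" using e by (auto simp: blue_def)
    qed
    show "(\<lambda>u. {v, u}) ` (K \<inter> blue v) \<subseteq> {e \<in> induced E K. v \<in> e}"
      using assms E by (auto simp: induced_def nsets_def blue_def colorings_def)
  qed
  moreover have "inj_on (\<lambda>u. {v, u}) (K \<inter> blue v)"
    by (auto simp: inj_on_def doubleton_eq_iff)
  ultimately show ?thesis by (simp add: degree_def card_image)
qed

lemma degree_induced_less:
  assumes "K \<in> [V]\<^bsup>k\<^esup>" "v \<in> K"
  shows "degree (induced E K) v < k"
proof -
  have K: "K \<subseteq> V" "finite K" "card K = k" using assms by (auto simp: nsets_def)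
  have "card (K \<inter> blue v) < card K"
    using assms K blue_subset[of v] by (intro psubset_card_mono) auto
  then show ?thesis using degree_induced[OF K(1) assms(2)] K by simp
qed

text \<open>
  A copy with root \<open>v\<close> is determined by its blue and its red part, which can be chosen independently.
\<close>

lemma card_rooted:
  assumes v: "v \<in> V" and D: "D \<subseteq> V - {v}" and i: "i < k"
  shows "card {K \<in> [V]\<^bsup>k\<^esup>. v \<in> K \<and> D \<subseteq> K \<and> degree (induced E K) v = i} =
    card {C. C \<subseteq> blue v \<and> D \<inter> blue v \<subseteq> C \<and> card C = i} *
    card {C. C \<subseteq> red v \<and> D \<inter> red v \<subseteq> C \<and> card C = k - 1 - i}" (is "card ?L = card ?\<A> * card ?\<B>")
proof -
  let ?R = "{K. K \<subseteq> blue v \<union> red v \<and> K \<inter> blue v \<in> ?\<A> \<and> K \<inter> red v \<in> ?\<B>}"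
  have vb: "v \<notin> blue v" "v \<notin> red v" using blue_subset by (auto simp: red_def)
  have card: "card K = card (K \<inter> blue v) + card (K \<inter> red v)" if "K \<subseteq> blue v \<union> red v" for K
  proof -
    have "card ((K \<inter> blue v) \<union> (K \<inter> red v)) = card (K \<inter> blue v) + card (K \<inter> red v)"
      using finite_blue_red blue_red_split(2)[of v] by (intro card_Un_disjoint) auto
    moreover have "(K \<inter> blue v) \<union> (K \<inter> red v) = K" using that by blast
    ultimately show ?thesis by simp
  qed
  have "bij_betw (insert v) ?R ?L"
  proof (rule bij_betwI[where g = "\<lambda>K. K - {v}"])
    show "insert v \<in> ?R \<rightarrow> ?L"
    proof
      fix K assume K: "K \<in> ?R"
      then have KV: "K \<subseteq> V - {v}" by (simp add: blue_red_split)
      have "finite K" using KV finite_V finite_subset by blast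
      moreover have "D \<subseteq> K" using K D blue_red_split(1)[of v] by blast
      moreover have "card K = k - 1" using card[of K] K i by auto
      moreover have "insert v K \<inter> blue v = K \<inter> blue v" using vb by blast
      moreover have "card (insert v K) = k"
        using \<open>finite K\<close> \<open>card K = k - 1\<close> KV i by (subst card_insert_disjoint) auto
      ultimately show "insert v K \<in> ?L"
        using K KV v i degree_induced[of "insert v K" v] by (auto simp: nsets_def subset_insert_iff)
    qed
    show "(\<lambda>K. K - {v}) \<in> ?L \<rightarrow> ?R"
    proof
      fix K assume K: "K \<in> ?L"
      then have KV: "K \<subseteq> V" "finite K" "card K = k" "v \<in> K" by (auto simp: nsets_def)
      have sub: "K - {v} \<subseteq> blue v \<union> red v" using KV by (auto simp: blue_red_split)
      have "(K - {v}) \<inter> blue v = K \<inter> blue v" using vb by blast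
      then have i': "card ((K - {v}) \<inter> blue v) = i" using K degree_induced[OF KV(1,4)] by simp
      moreover have "card ((K - {v}) \<inter> red v) = k - 1 - i"
        using card[OF sub] i' KV by simp
      ultimately show "K - {v} \<in> ?R" using K sub D by auto
    qed
  qed (use vb in auto)
  then have "card ?L = card ?R" by (simp add: bij_betw_same_card)
  also have "\<dots> = card ?\<A> * card ?\<B>"
    by (rule card_subsets_split) (use finite_blue_red blue_red_split in auto)
  finally show ?thesis .
qed

lemma sum_rooted:
  "(\<Sum>K | K \<in> [V]\<^bsup>k\<^esup> \<and> v \<in> K \<and> D \<subseteq> K. p (degree (induced E K) v)) =
    (\<Sum>i<k. real (card {K \<in> [V]\<^bsup>k\<^esup>. v \<in> K \<and> D \<subseteq> K \<and> degree (induced E K) v = i}) * p i)"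
proof -
  let ?S = "{K. K \<in> [V]\<^bsup>k\<^esup> \<and> v \<in> K \<and> D \<subseteq> K}"
  have "finite ?S" using finite_V by (simp add: finite_imp_finite_nsets)
  then have "(\<Sum>K\<in>?S. p (degree (induced E K) v)) =
    (\<Sum>i<k. \<Sum>K\<in>{K \<in> ?S. degree (induced E K) v = i}. p (degree (induced E K) v))"
    using degree_induced_less by (intro sum.group[symmetric]) auto
  also have "\<dots> = (\<Sum>i<k. real (card {K \<in> ?S. degree (induced E K) v = i}) * p i)"
    by (intro sum.cong) auto
  finally show ?thesis by (simp add: conj_assoc)
qed

lemma bdens_bounds: "0 \<le> bdens v" "bdens v \<le> 1"
proof -
  have "card (blue v) \<le> card V" using blue_subset finite_V by (intro card_mono) auto
  then show "0 \<le> bdens v" "bdens v \<le> 1" by (auto simp: bdens_def divide_le_eq)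
qed

lemma card_blue_bdens: "v \<in> V \<Longrightarrow> real (card (blue v)) = real (card V) * bdens v"
  and card_red_bdens: "v \<in> V \<Longrightarrow> real (card (red v)) + 1 = real (card V) * (1 - bdens v)"
  using card_blue_red[of v] finite_V
  by (auto simp: bdens_def right_diff_distrib dest: card_gt_0_iff[THEN iffD2, rotated])

lemma card_split_root:
  assumes "D \<subseteq> V - {v}"
  shows "card (D \<inter> blue v) + card (D \<inter> red v) = card D"
proof -
  have "card ((D \<inter> blue v) \<union> (D \<inter> red v)) = card (D \<inter> blue v) + card (D \<inter> red v)"
    using finite_blue_red blue_red_split(2)[of v] by (intro card_Un_disjoint) auto
  moreover have "(D \<inter> blue v) \<union> (D \<inter> red v) = D" using assms blue_red_split(1)[of v] by blast
  ultimately show ?thesis by simp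
qed

text \<open>
  No error term occurs in this direction, because falling factorials are at most powers. Hence the
  fractional packing satisfies its constraints exactly for every \<open>n\<close>.
\<close>

lemma sum_rooted_upper:
  assumes v: "v \<in> V" and D: "D \<subseteq> V - {v}" "card D < k" and p: "\<And>i. 0 \<le> p i"
  shows "(\<Sum>K | K \<in> [V]\<^bsup>k\<^esup> \<and> v \<in> K \<and> D \<subseteq> K. p (degree (induced E K) v)) \<le>
    real (card V) ^ (k - 1 - card D) * type_sum k (bdens v) p (card (D \<inter> blue v)) (card (D \<inter> red v))"
proof -
  let ?n = "real (card V)" and ?x = "bdens v" and ?a = "card (D \<inter> blue v)" and ?b = "card (D \<inter> red v)"
  have ab: "?a + ?b = card D" using D(1) by (rule card_split_root)
  show ?thesis unfolding sum_rooted type_sum_def sum_distrib_left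
  proof (rule sum_mono)
    fix i assume "i \<in> {..<k}"
    then have i: "i < k" by simp
    have "real (card {K \<in> [V]\<^bsup>k\<^esup>. v \<in> K \<and> D \<subseteq> K \<and> degree (induced E K) v = i})
      \<le> pow_div_fact (card (blue v)) (int i - int ?a) * pow_div_fact (card (red v)) (int (k - 1 - i) - int ?b)"
      unfolding card_rooted[OF v D(1) i] of_nat_mult
      by (intro mult_mono card_supersets_le finite_blue_red pow_div_fact_nonneg) auto
    also have "\<dots> \<le> pow_div_fact (?n * ?x) (int i - int ?a) * pow_div_fact (?n * (1 - ?x)) (int (k - 1 - i) - int ?b)"
      unfolding card_blue_bdens[OF v, symmetric] card_red_bdens[OF v, symmetric]
      by (intro mult_left_mono pow_div_fact_mono pow_div_fact_nonneg) auto
    also have "\<dots> = ?n ^ (k - 1 - card D) *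
        (pow_div_fact ?x (int i - int ?a) * pow_div_fact (1 - ?x) (int (k - 1 - i) - int ?b))"
      (is "_ = ?bound")
    proof (cases "?a \<le> i \<and> ?b \<le> k - 1 - i")
      case True
      then have "k - 1 - card D = (i - ?a) + (k - 1 - i - ?b)" using ab i by linarith
      then show ?thesis unfolding pow_div_fact_scale by (simp add: power_add)
    next
      case False
      then show ?thesis unfolding pow_div_fact_scale by (auto simp: pow_div_fact_diff)
    qed
    finally have "real (card {K \<in> [V]\<^bsup>k\<^esup>. v \<in> K \<and> D \<subseteq> K \<and> degree (induced E K) v = i}) * p i
      \<le> ?bound * p i" by (rule mult_right_mono) (rule p)
    then show "real (card {K \<in> [V]\<^bsup>k\<^esup>. v \<in> K \<and> D \<subseteq> K \<and> degree (induced E K) v = i}) * p i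
      \<le> ?n ^ (k - 1 - card D) * (pow_div_fact ?x (int i - int ?a) *
        pow_div_fact (1 - ?x) (int (k - 1 - i) - int ?b) * p i)"
      by (simp only: mult.assoc)
  qed
qed

lemma sum_rooted_lower:
  assumes v: "v \<in> V" and p: "\<And>i. 0 \<le> p i \<and> p i \<le> C"
  shows "(\<Sum>K | K \<in> [V]\<^bsup>k\<^esup> \<and> v \<in> K. p (degree (induced E K) v)) \<ge>
    real (card V) ^ (k - 1) * type_sum k (bdens v) p 0 0
      - 2 * real k ^ 3 * C * real (card V) ^ (k - 1) / real (card V)"
proof -
  let ?n = "real (card V)" and ?x = "bdens v"
  let ?err = "2 * real k ^ 2 * ?n ^ (k - 1) / ?n"
  have "?n ^ (k - 1) * type_sum k ?x p 0 0 - 2 * real k ^ 3 * C * ?n ^ (k - 1) / ?n =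
    (\<Sum>i<k. ?n ^ (k - 1) * (pow_div_fact ?x (int i - int 0) *
        pow_div_fact (1 - ?x) (int (k - 1 - i) - int 0)) * p i - ?err * C)"
    unfolding type_sum_def by (simp add: sum_subtractf sum_distrib_left power2_eq_square power3_eq_cube mult.assoc)
  also have "\<dots> \<le> (\<Sum>i<k. real (card {K \<in> [V]\<^bsup>k\<^esup>. v \<in> K \<and> {} \<subseteq> K \<and> degree (induced E K) v = i}) * p i)"
  proof (rule sum_mono)
    fix i assume "i \<in> {..<k}"
    then have i: "i < k" by simp
    have "?n ^ (k - 1) * (pow_div_fact ?x (int i - int 0) * pow_div_fact (1 - ?x) (int (k - 1 - i) - int 0))
      = pow_div_fact (?n * ?x) (int i - int 0) * pow_div_fact (?n * (1 - ?x)) (int (k - 1 - i) - int 0)"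
    proof -
      have "k - 1 = i + (k - 1 - i)" using i by simp
      then have "?n ^ (k - 1) = ?n ^ i * ?n ^ (k - 1 - i)" by (metis power_add)
      then show ?thesis unfolding pow_div_fact_scale by simp
    qed
    also have "\<dots> = real (card (blue v)) ^ i / fact i * ((?n - real (card (blue v))) ^ (k - 1 - i) / fact (k - 1 - i))"
      unfolding card_blue_bdens[OF v, symmetric]
      by (simp only: pow_div_fact_diff right_diff_distrib card_blue_bdens[OF v]) simp
    finally have eq: "?n ^ (k - 1) * (pow_div_fact ?x (int i - int 0) *
        pow_div_fact (1 - ?x) (int (k - 1 - i) - int 0)) = \<dots>" .
    have "{C. C \<subseteq> blue v \<and> {} \<inter> blue v \<subseteq> C \<and> card C = i} = {C. C \<subseteq> blue v \<and> card C = i}"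
      "{C. C \<subseteq> red v \<and> {} \<inter> red v \<subseteq> C \<and> card C = k - 1 - i} = {C. C \<subseteq> red v \<and> card C = k - 1 - i}"
      by auto
    then have count: "real (card {K \<in> [V]\<^bsup>k\<^esup>. v \<in> K \<and> {} \<subseteq> K \<and> degree (induced E K) v = i}) =
        real (card (blue v) choose i) * real (card (red v) choose (k - 1 - i))"
      using card_rooted[OF v _ i, of "{}"] n_subsets[OF finite_blue_red(1)] n_subsets[OF finite_blue_red(2)]
      by simp
    have "?n ^ (k - 1) * (pow_div_fact ?x (int i - int 0) * pow_div_fact (1 - ?x) (int (k - 1 - i) - int 0)) - ?err
      \<le> real (card (blue v) choose i) * real (card (red v) choose (k - 1 - i))"
      unfolding eq using i by (intro binomial_product_lower card_blue_red[OF v]) simp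
    from mult_right_mono[OF this, of "p i"]
    have "?n ^ (k - 1) * (pow_div_fact ?x (int i - int 0) * pow_div_fact (1 - ?x) (int (k - 1 - i) - int 0)) * p i
       - ?err * p i \<le> real (card (blue v) choose i) * real (card (red v) choose (k - 1 - i)) * p i"
      using p by (simp add: left_diff_distrib)
    moreover have "?err * p i \<le> ?err * C" using p by (intro mult_left_mono) auto
    ultimately show "?n ^ (k - 1) * (pow_div_fact ?x (int i - int 0) *
        pow_div_fact (1 - ?x) (int (k - 1 - i) - int 0)) * p i - ?err * C
      \<le> real (card {K \<in> [V]\<^bsup>k\<^esup>. v \<in> K \<and> {} \<subseteq> K \<and> degree (induced E K) v = i}) * p i"
      unfolding count by linarith
  qed
  also have "\<dots> = (\<Sum>K | K \<in> [V]\<^bsup>k\<^esup> \<and> v \<in> K. p (degree (induced E K) v))"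
    using sum_rooted[where D = "{}"] by simp
  finally show ?thesis .
qed

end

section \<open>The fractional packing and its rounding\<close>

context coloring
begin

text \<open>
  Each vertex of \<open>K\<close> acts as a root once. With root weights for \<open>P\<close>, the factor in front makes the load of an edge at most
  \<open>1\<close>: there are at most \<open>n\<close> roots outside the edge, each giving at most \<open>n\<^bsup>k-3\<^esup>\<close>, and two on it, each giving at most
  \<open>n\<^bsup>k-2\<^esup> / (k - 2)\<close>.
\<close>

definition weight :: "nat \<Rightarrow> ('a \<Rightarrow> nat \<Rightarrow> real) \<Rightarrow> 'a set \<Rightarrow> real"
  where "weight k P K = (real k - 2) / (real k * real (card V) ^ (k - 2)) *
    (\<Sum>v\<in>K. P v (degree (induced E K) v))"

lemma sum_weight:
  "(\<Sum>K | K \<in> [V]\<^bsup>k\<^esup> \<and> D \<subseteq> K. weight k P K) = (real k - 2) / (real k * real (card V) ^ (k - 2)) *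
    (\<Sum>v\<in>V. \<Sum>K | K \<in> [V]\<^bsup>k\<^esup> \<and> v \<in> K \<and> D \<subseteq> K. P v (degree (induced E K) v))"
proof -
  let ?A = "{K. K \<in> [V]\<^bsup>k\<^esup> \<and> D \<subseteq> K}"
  have finA: "finite ?A" using finite_V by (simp add: finite_imp_finite_nsets)
  have "(\<Sum>K\<in>?A. \<Sum>v\<in>K. P v (degree (induced E K) v))
    = (\<Sum>K\<in>?A. \<Sum>v | v \<in> V \<and> v \<in> K. P v (degree (induced E K) v))"
    by (intro sum.cong) (auto simp: nsets_def)
  also have "\<dots> = (\<Sum>v\<in>V. \<Sum>K | K \<in> ?A \<and> v \<in> K. P v (degree (induced E K) v))"
    by (rule sum.swap_restrict[OF finA finite_V])
  also have "\<dots> = (\<Sum>v\<in>V. \<Sum>K | K \<in> [V]\<^bsup>k\<^esup> \<and> v \<in> K \<and> D \<subseteq> K. P v (degree (induced E K) v))"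
    by (intro sum.cong) auto
  finally show ?thesis by (simp only: weight_def sum_distrib_left[symmetric])
qed

context
  fixes k :: nat and d C :: real and P :: "'a \<Rightarrow> nat \<Rightarrow> real"
  assumes k: "k \<ge> 3" and P: "\<And>v. v \<in> V \<Longrightarrow> root_weight k d C (bdens v) (P v)"
begin

lemma weight_nonneg: "K \<subseteq> V \<Longrightarrow> 0 \<le> weight k P K"
  unfolding weight_def using k P
  by (intro mult_nonneg_nonneg sum_nonneg) (auto simp: root_weight_def subset_iff)

lemma sum_weight_edge_le:
  assumes f: "f \<in> [V]\<^bsup>2\<^esup>"
  shows "(\<Sum>K | K \<in> [V]\<^bsup>k\<^esup> \<and> f \<subseteq> K. weight k P K) \<le> 1"
proof -
  let ?n = "real (card V)" and ?B = "real (card V) ^ (k - 2)"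
  have fV: "f \<subseteq> V" "card f = 2" "finite f" using f by (auto simp: nsets_def)
  have n: "0 < ?n" using fV finite_V by (auto simp: card_gt_0_iff)
  have P0: "0 \<le> P v i" if "v \<in> V" for v i using P[OF that] by (simp add: root_weight_def)
  let ?g = "\<lambda>v. \<Sum>K | K \<in> [V]\<^bsup>k\<^esup> \<and> v \<in> K \<and> f \<subseteq> K. P v (degree (induced E K) v)"
  have outside: "?g v \<le> ?n ^ (k - 3)" if v: "v \<in> V - f" for v
  proof -
    have D: "f \<subseteq> V - {v}" using v fV by auto
    have "?g v \<le> ?n ^ (k - 1 - card f) * type_sum k (bdens v) (P v) (card (f \<inter> blue v)) (card (f \<inter> red v))"
      using v fV k D P0 by (intro sum_rooted_upper) auto
    also have "\<dots> \<le> ?n ^ (k - 1 - card f) * 1"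
      using v fV k card_split_root[OF D]
      by (intro mult_left_mono root_weight_pair_le(1)[OF P bdens_bounds]) auto
    finally show ?thesis using fV by (simp add: numeral_3_eq_3)
  qed
  have inside: "?g v \<le> ?B * (1 / (real k - 2))" if v: "v \<in> f" for v
  proof -
    let ?D = "f - {v}"
    have D: "?D \<subseteq> V - {v}" "card ?D = 1" using v fV by auto
    have vV: "v \<in> V" using v fV by auto
    have "?g v = (\<Sum>K | K \<in> [V]\<^bsup>k\<^esup> \<and> v \<in> K \<and> ?D \<subseteq> K. P v (degree (induced E K) v))"
      using v by (intro sum.cong) auto
    also have "\<dots> \<le> ?n ^ (k - 1 - card ?D) *
        type_sum k (bdens v) (P v) (card (?D \<inter> blue v)) (card (?D \<inter> red v))"
      using vV k D P0 by (intro sum_rooted_upper) auto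
    also have "\<dots> \<le> ?n ^ (k - 1 - card ?D) * (1 / (real k - 2))"
      using vV k D(2) card_split_root[OF D(1)]
      by (intro mult_left_mono root_weight_pair_le(2)[OF P bdens_bounds]) auto
    finally show ?thesis unfolding D(2) by (simp add: numeral_2_eq_2)
  qed
  have "(\<Sum>v\<in>V. ?g v) = (\<Sum>v\<in>V - f. ?g v) + (\<Sum>v\<in>f. ?g v)"
    by (rule sum.subset_diff[OF fV(1) finite_V])
  also have "\<dots> \<le> (\<Sum>v\<in>V - f. ?n ^ (k - 3)) + (\<Sum>v\<in>f. ?B * (1 / (real k - 2)))"
    by (intro add_mono sum_mono outside inside)
  also have "\<dots> \<le> ?n * ?n ^ (k - 3) + 2 * (?B * (1 / (real k - 2)))"
  proof -
    have "card (V - f) \<le> card V" using finite_V by (intro card_mono) auto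
    then show ?thesis using fV by (intro add_mono) (auto intro!: mult_right_mono)
  qed
  also have "?n * ?n ^ (k - 3) = ?B"
    using k by (simp add: power_Suc[symmetric] Suc_diff_le numeral_3_eq_3 numeral_2_eq_2 Suc_diff_Suc)
  also have "?B + 2 * (?B * (1 / (real k - 2))) = ?B * real k / (real k - 2)"
    using k by (simp add: field_simps)
  finally have "(\<Sum>K | K \<in> [V]\<^bsup>k\<^esup> \<and> f \<subseteq> K. weight k P K) \<le>
      (real k - 2) / (real k * ?B) * (?B * real k / (real k - 2))"
    unfolding sum_weight using k by (intro mult_left_mono) auto
  also have "\<dots> = 1" using k n by simp
  finally show ?thesis .
qed

lemma sum_weight_lower:
  assumes n: "card V > 0"
  shows "(\<Sum>K\<in>[V]\<^bsup>k\<^esup>. weight k P K) \<ge>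
    real (card V) ^ 2 * (1 - d) ^ (k - 1) / (real k * (real k - 1)) - 2 * real k ^ 3 * C * real (card V)"
proof -
  let ?n = "real (card V)"
  define L where "L = (real k - 2) / (real k * ?n ^ (k - 2))"
  define m where "m = (1 - d) ^ (k - 1) / ((real k - 1) * (real k - 2))"
  have n0: "0 < ?n" using n by simp
  have k2: "real k - 2 > 0" "real k - 1 > 0" using k by auto
  have C: "0 \<le> C"
  proof -
    obtain v where "v \<in> V" using n by (metis card_gt_0_iff equals0I)
    then show ?thesis using P[of v] order.trans unfolding root_weight_def by blast
  qed
  have L: "0 \<le> L" using k2 by (simp add: L_def)
  have Ln: "L * (?n * ?n ^ (k - 1)) = (real k - 2) / real k * ?n ^ 2"
  proof -
    have "k - 1 = Suc (k - 2)" using k by simp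
    then have "?n * ?n ^ (k - 1) = ?n ^ (k - 2) * ?n ^ 2"
      by (simp add: power2_eq_square)
    then show ?thesis unfolding L_def using n0 by simp
  qed
  have root: "(\<Sum>K | K \<in> [V]\<^bsup>k\<^esup> \<and> v \<in> K \<and> {} \<subseteq> K. P v (degree (induced E K) v)) \<ge>
      ?n ^ (k - 1) * m - 2 * real k ^ 3 * C * ?n ^ (k - 1) / ?n" if v: "v \<in> V" for v
  proof -
    have rw: "root_weight k d C (bdens v) (P v)" using P[OF v] .
    have "?n ^ (k - 1) * m \<le> ?n ^ (k - 1) * type_sum k (bdens v) (P v) 0 0"
      using rw n0 by (intro mult_left_mono) (auto simp: root_weight_def m_def)
    moreover have "(\<Sum>K | K \<in> [V]\<^bsup>k\<^esup> \<and> v \<in> K. P v (degree (induced E K) v)) \<ge>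
      ?n ^ (k - 1) * type_sum k (bdens v) (P v) 0 0 - 2 * real k ^ 3 * C * ?n ^ (k - 1) / ?n"
      using rw by (intro sum_rooted_lower[OF v]) (auto simp: root_weight_def)
    ultimately show ?thesis by simp
  qed
  have "?n ^ 2 * (1 - d) ^ (k - 1) / (real k * (real k - 1)) - 2 * real k ^ 3 * C * ?n
      \<le> L * (?n * ?n ^ (k - 1)) * (m - 2 * real k ^ 3 * C / ?n)"
  proof -
    have "L * (?n * ?n ^ (k - 1)) * m = ?n ^ 2 * (1 - d) ^ (k - 1) / (real k * (real k - 1))"
      unfolding Ln m_def using k2 by simp
    moreover have "L * (?n * ?n ^ (k - 1)) * (2 * real k ^ 3 * C / ?n) =
        (real k - 2) / real k * (2 * real k ^ 3 * C * ?n)"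
      unfolding Ln using n0 by (simp add: power2_eq_square)
    moreover have "(real k - 2) / real k * (2 * real k ^ 3 * C * ?n) \<le> 1 * (2 * real k ^ 3 * C * ?n)"
      using k C by (intro mult_right_mono) auto
    ultimately show ?thesis by (simp add: right_diff_distrib)
  qed
  also have "\<dots> = L * (\<Sum>v\<in>V. ?n ^ (k - 1) * m - 2 * real k ^ 3 * C * ?n ^ (k - 1) / ?n)"
    by (simp add: right_diff_distrib mult.assoc)
  also have "\<dots> \<le> L * (\<Sum>v\<in>V. \<Sum>K | K \<in> [V]\<^bsup>k\<^esup> \<and> v \<in> K \<and> {} \<subseteq> K. P v (degree (induced E K) v))"
    by (intro mult_left_mono sum_mono root L)
  also have "\<dots> = (\<Sum>K | K \<in> [V]\<^bsup>k\<^esup> \<and> {} \<subseteq> K. weight k P K)"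
    unfolding sum_weight L_def ..
  finally show ?thesis by simp
qed

text \<open>
  Two distinct edges span at least three vertices, so there are at most \<open>n\<^bsup>k-3\<^esup>\<close> copies through both, each of weight
  \<open>O(1 / n\<^bsup>k-2\<^esup>)\<close>.
\<close>

lemma sum_weight_pair_le:
  assumes f: "f \<in> [V]\<^bsup>2\<^esup>" and g: "g \<in> [V]\<^bsup>2\<^esup>" and fg: "f \<noteq> g"
  shows "(\<Sum>K | K \<in> [V]\<^bsup>k\<^esup> \<and> f \<subseteq> K \<and> g \<subseteq> K. weight k P K) \<le> real k * C / real (card V)"
proof -
  let ?n = "real (card V)"
  have fg': "f \<subseteq> V" "card f = 2" "finite f" "g \<subseteq> V" "card g = 2" "finite g"
    using f g by (auto simp: nsets_def)
  have n: "0 < ?n" using fg' finite_V by (auto simp: card_gt_0_iff)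
  obtain v where v: "v \<in> V" using fg'(1,2) by fastforce
  have C: "0 \<le> C" using P[OF v] order.trans unfolding root_weight_def by blast
  have "\<not> g \<subseteq> f" using fg fg' card_subset_eq by metis
  then obtain u where u: "u \<in> g" "u \<notin> f" by blast
  let ?D = "insert u f"
  have D: "card ?D = 3" "?D \<subseteq> V" using u fg' by auto
  let ?A = "{K. K \<in> [V]\<^bsup>k\<^esup> \<and> f \<subseteq> K \<and> g \<subseteq> K}"
  have finA: "finite {K. K \<subseteq> V \<and> ?D \<subseteq> K \<and> card K = k}" using finite_V by simp
  have "?A \<subseteq> {K. K \<subseteq> V \<and> ?D \<subseteq> K \<and> card K = k}" using u by (auto simp: nsets_def)
  then have "real (card ?A) \<le> real (card {K. K \<subseteq> V \<and> ?D \<subseteq> K \<and> card K = k})"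
    unfolding of_nat_le_iff by (rule card_mono[OF finA])
  also have "\<dots> \<le> pow_div_fact ?n (int k - int (card ?D))" by (rule card_supersets_le[OF finite_V D(2)])
  also have "\<dots> = ?n ^ (k - 3) / fact (k - 3)" unfolding D pow_div_fact_diff using k by simp
  also have "\<dots> \<le> ?n ^ (k - 3)"
    using n fact_ge_1[of "k - 3", where 'a = real] by (simp add: divide_le_eq)
  finally have count: "real (card ?A) \<le> ?n ^ (k - 3)" .
  have each: "weight k P K \<le> (real k - 2) / (real k * ?n ^ (k - 2)) * (real k * C)" if "K \<in> ?A" for K
  proof -
    have K: "K \<subseteq> V" "card K = k" using that by (auto simp: nsets_def)
    have "(\<Sum>v\<in>K. P v (degree (induced E K) v)) \<le> (\<Sum>v\<in>K. C)"
      using P K by (intro sum_mono) (auto simp: root_weight_def)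
    then show ?thesis unfolding weight_def using k K by (intro mult_left_mono) auto
  qed
  have "(\<Sum>K\<in>?A. weight k P K) \<le> (\<Sum>K\<in>?A. (real k - 2) / (real k * ?n ^ (k - 2)) * (real k * C))"
    by (rule sum_mono) (rule each)
  also have "\<dots> = real (card ?A) * ((real k - 2) / (real k * ?n ^ (k - 2)) * (real k * C))" by simp
  also have "\<dots> \<le> ?n ^ (k - 3) * ((real k - 2) / (real k * ?n ^ (k - 2)) * (real k * C))"
    using count k C n by (intro mult_right_mono) auto
  also have "\<dots> = (real k - 2) * C / ?n"
  proof -
    have "k - 2 = Suc (k - 3)" using k by simp
    then have "?n ^ (k - 2) = ?n * ?n ^ (k - 3)" by simp
    then show ?thesis using n k by (simp only:) simp
  qed
  also have "\<dots> \<le> real k * C / ?n" using C n by (intro divide_right_mono mult_right_mono) auto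
  finally show ?thesis .
qed

end

lemma copy_outside_degree_family:
  assumes A: "A \<in> [V]\<^bsup>k\<^esup>" and v: "v \<in> A" "degree (induced E A) v \<notin> S"
  shows "\<exists>c\<in>\<C> k - degree_family S k. \<exists>H\<in>c. coloring_iso A (induced E A) {..<k} H"
proof -
  have "finite A" "card A = k" using A by (auto simp: nsets_def)
  then obtain f where f: "bij_betw f A {..<k}"
    using finite_same_card_bij[of A "{..<k}"] by auto
  define H where "H = (\<lambda>e. f ` e) ` induced E A"
  have col: "induced E A \<in> colorings A" by (simp add: colorings_def induced_def)
  have iso: "coloring_iso A (induced E A) {..<k} H"
    unfolding coloring_iso_def H_def using f by blast
  have "f ` e \<in> [{..<k}]\<^bsup>2\<^esup>" if "e \<in> induced E A" for e
  proof -
    have e: "e \<subseteq> A" "finite e" "card e = 2" using that by (auto simp: induced_def nsets_def)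
    have "inj_on f e" using f e(1) inj_on_subset by (auto simp: bij_betw_def)
    then show ?thesis using e f by (auto simp: nsets_def card_image bij_betw_def)
  qed
  then have H: "H \<in> colorings {..<k}" by (auto simp: H_def colorings_def)
  let ?c = "iso_rel k `` {H}"
  have Hc: "H \<in> ?c" using H by (rule equiv_class_self[OF equiv_iso_rel])
  have "?c \<in> \<C> k" unfolding coloring_classes_def using H by (rule quotientI)
  moreover have "?c \<notin> degree_family S k"
  proof
    assume "?c \<in> degree_family S k"
    then have "degree_set {..<k} H \<subseteq> S" using Hc by (auto simp: degree_family_def)
    then have "degree_set A (induced E A) \<subseteq> S" using degree_set_iso[OF col iso] by simp
    then show False using v by (auto simp: degree_set_def)
  qed
  ultimately show ?thesis using Hc iso by blast
qed

end

lemma type_sum_restrict: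
  assumes "T \<subseteq> {..<k}"
  shows "type_sum k x (\<lambda>i. if i \<in> T then p i else 0) a b = (\<Sum>i\<in>T. pow_div_fact x (int i - int a) *
    pow_div_fact (1 - x) (int (k - 1 - i) - int b) * p i)"
  unfolding type_sum_def using assms by (intro sum.mono_neutral_cong_right) auto

lemma nsets_2_subset_iff: "f \<in> [V]\<^bsup>2\<^esup> \<Longrightarrow> f \<in> [K]\<^bsup>2\<^esup> \<longleftrightarrow> f \<subseteq> K"
  by (auto simp: nsets_def)

theorem theorem4:
  fixes k :: nat and S :: "nat set"
  assumes "k \<ge> 2"
    and "S \<subseteq> {0..k - 1}"
    and "\<And>x :: real. 0 < x \<Longrightarrow> x < 1 \<Longrightarrow>
      \<exists>p :: nat \<Rightarrow> real.
        (\<forall>i \<in> {0..k - 1} - S. p i \<ge> 0) \<and>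
        (\<Sum>i \<in> {0..k - 1} - S.
           pow_div_fact x (int i - 2) * pow_div_fact (1 - x) (int k - 1 - int i) * p i) = 1 \<and>
        (\<Sum>i \<in> {0..k - 1} - S.
           pow_div_fact x (int i) * pow_div_fact (1 - x) (int k - 3 - int i) * p i) = 1 \<and>
        (\<Sum>i \<in> {0..k - 1} - S.
           pow_div_fact x (int i - 1) * pow_div_fact (1 - x) (int k - 2 - int i) * p i) = 1"
  shows "avoidable k (degree_family S k)"
proof -
  define T where "T = {0..k - 1} - S"
  have T: "T \<subseteq> {..<k}" using assms(1) by (auto simp: T_def)
  \<comment> \<open>For \<open>k = 2\<close> all coefficients of the second equation vanish.\<close>
  have k: "k \<ge> 3"
  proof (rule ccontr)
    assume "\<not> k \<ge> 3"
    then have "k = 2" using assms(1) by simp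
    then have "pow_div_fact y (int k - 3 - int i) = 0" for y i
      by (simp add: pow_div_fact_def)
    then show False using assms(3)[of "1 / 2"] by simp
  qed
  have sol: "\<exists>p. balanced k x p \<and> (\<forall>i. i \<notin> T \<longrightarrow> p i = 0)" if x: "0 < x" "x < 1" for x
  proof -
    obtain p where p: "\<forall>i\<in>T. p i \<ge> 0"
      "(\<Sum>i\<in>T. pow_div_fact x (int i - 2) * pow_div_fact (1 - x) (int k - 1 - int i) * p i) = 1"
      "(\<Sum>i\<in>T. pow_div_fact x (int i) * pow_div_fact (1 - x) (int k - 3 - int i) * p i) = 1"
      "(\<Sum>i\<in>T. pow_div_fact x (int i - 1) * pow_div_fact (1 - x) (int k - 2 - int i) * p i) = 1"
      using assms(3)[OF x] unfolding T_def by blast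
    let ?q = "\<lambda>i. if i \<in> T then p i else 0"
    have blue_arg: "int i - int 0 = int i" "int i - int 1 = int i - 1" "int i - int 2 = int i - 2" for i
      by simp_all
    have red_arg: "int (k - 1 - i) - int 0 = int k - 1 - int i" "int (k - 1 - i) - int 1 = int k - 2 - int i"
      "int (k - 1 - i) - int 2 = int k - 3 - int i" if "i \<in> T" for i
      using that T by auto
    have "type_sum k x ?q 2 0 = 1" "type_sum k x ?q 1 1 = 1" "type_sum k x ?q 0 2 = 1"
      unfolding type_sum_restrict[OF T] using p(2-4) by (simp_all only: red_arg cong: sum.cong) (simp_all only: blue_arg)
    then have "balanced k x ?q" using p(1) by (simp add: balanced_def)
    then show ?thesis by (intro exI[of _ ?q]) simp
  qed
  have "asymptotic_packing_property k (\<C> k - degree_family S k)"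
    unfolding asymptotic_packing_property_def
  proof (intro allI impI)
    fix \<epsilon> :: real
    assume "\<epsilon> > 0"
    define \<delta> where "\<delta> = min \<epsilon> 1"
    have \<delta>: "0 < \<delta>" "\<delta> \<le> 1" "\<delta> \<le> \<epsilon>" using \<open>\<epsilon> > 0\<close> by (auto simp: \<delta>_def)
    \<comment> \<open>The error \<open>\<delta>\<close> is split into \<open>\<delta> / 3\<close> for the vertices of
      extreme degree, \<open>\<delta> / 6\<close> for the rounding and \<open>\<delta> / 2\<close> for lower order
      terms in \<open>n\<close>.\<close>
    define d where "d = \<delta> / (3 * real k)"
    define C where "C = (fact (k - 1))\<^sup>2 / d ^ (k - 1)"
    define R where "R = real k * (real k - 1)"
    have R: "0 < R" using k by (simp add: R_def)
    have d: "0 < d" "d \<le> 1 / 2" using \<delta> k by (auto simp: d_def field_simps)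
    have C: "0 \<le> C" using d by (simp add: C_def)
    have d_pow: "(1 - d) ^ (k - 1) \<ge> 1 - \<delta> / 3"
    proof -
      have "real (k - 1) * d \<le> real k * d" using d by (intro mult_right_mono) auto
      also have "\<dots> = \<delta> / 3" using k by (simp add: d_def)
      finally show ?thesis using Bernoulli_inequality[of "- d" "k - 1"] d by simp
    qed
    have "\<forall>x. \<exists>p. 0 \<le> x \<longrightarrow> x \<le> 1 \<longrightarrow> root_weight k d C x p \<and> (\<forall>i. i \<notin> T \<longrightarrow> p i = 0)"
      unfolding C_def using root_weight_exists[OF k d sol T] by blast
    then obtain p where p: "\<And>x. 0 \<le> x \<Longrightarrow> x \<le> 1 \<Longrightarrow> root_weight k d C x (p x)"
      and pT: "\<And>x i. 0 \<le> x \<Longrightarrow> x \<le> 1 \<Longrightarrow> i \<notin> T \<Longrightarrow> p x i = 0"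
      by metis
    have r: "0 < k choose 2" using k by (intro zero_less_binomial) simp
    have "0 < \<delta> / (3 * R)" using \<delta> R by simp
    then show "\<forall>\<^sub>F n in sequentially. \<forall>E\<in>colorings {..<n}. \<exists>P.
         is_packing k (\<C> k - degree_family S k) {..<n} E P \<and>
         real n * (real n - 1) / (real k * (real k - 1)) * (1 - \<epsilon>) \<le> real (card P)"
    proof (rule fractional_to_integral_matching[OF r, where 'a = "nat set" and 'b = "nat set"])
      fix \<kappa> :: real
      assume \<kappa>: "\<kappa> > 0" and round: "\<And>(V::nat set set) (I::nat set set) e w.
      finite V \<Longrightarrow> finite I \<Longrightarrow> (\<And>c. c \<in> I \<Longrightarrow> e c \<subseteq> V \<and> card (e c) = k choose 2) \<Longrightarrow>
      (\<And>c. c \<in> I \<Longrightarrow> 0 \<le> w c) \<Longrightarrow>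
      (\<And>f. f \<in> V \<Longrightarrow> (\<Sum>c | c \<in> I \<and> f \<in> e c. w c) \<le> 1) \<Longrightarrow>
      (\<And>f g. f \<in> V \<Longrightarrow> g \<in> V \<Longrightarrow> f \<noteq> g \<Longrightarrow>
        (\<Sum>c | c \<in> I \<and> f \<in> e c \<and> g \<in> e c. w c) \<le> \<kappa>) \<Longrightarrow>
      \<exists>M\<subseteq>I. pairwise (\<lambda>c d. disjnt (e c) (e d)) M \<and>
        real (card M) \<ge> sum w I - \<delta> / (3 * R) * real (card V)"
      obtain N :: nat where N: "2 + real k * C / \<kappa> + 4 * real k ^ 3 * C * R / \<delta> \<le> real N"
        using real_arch_simple by blast
      show "\<forall>\<^sub>F n in sequentially. \<forall>E\<in>colorings {..<n}. \<exists>P.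
           is_packing k (\<C> k - degree_family S k) {..<n} E P \<and>
           real n * (real n - 1) / (real k * (real k - 1)) * (1 - \<epsilon>) \<le> real (card P)"
        using eventually_ge_at_top[of N]
      proof (eventually_elim, intro ballI)
        fix n and E :: "nat set set"
        assume "n \<ge> N" and "E \<in> colorings {..<n}"
        interpret coloring "{..<n}" E by unfold_locales (use \<open>E \<in> _\<close> in auto)
        have terms: "0 \<le> real k * C / \<kappa>" "0 \<le> 4 * real k ^ 3 * C * R / \<delta>"
          using C \<kappa> R \<delta> by auto
        then have n: "2 \<le> real n" "real k * C / \<kappa> \<le> real n" "4 * real k ^ 3 * C * R / \<delta> \<le> real n - 1"
          using N \<open>n \<ge> N\<close> by linarith+
        let ?P = "\<lambda>v. p (bdens v)"
        have P: "root_weight k d C (bdens v) (?P v)" for v by (rule p[OF bdens_bounds])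
        define I where "I = {K \<in> [{..<n}]\<^bsup>k\<^esup>. \<exists>v\<in>K. degree (induced E K) v \<notin> S}"
        have I_sub: "I \<subseteq> [{..<n}]\<^bsup>k\<^esup>" by (auto simp: I_def)
        have fin: "finite ([{..<n}]\<^bsup>k\<^esup>)" by (simp add: finite_imp_finite_nsets)
        have w0: "0 \<le> weight k ?P K" if "K \<in> [{..<n}]\<^bsup>k\<^esup>" for K
          using that weight_nonneg[OF k P] by (auto simp: nsets_def)
        have total: "sum (weight k ?P) I = (\<Sum>K\<in>[{..<n}]\<^bsup>k\<^esup>. weight k ?P K)"
        proof (rule sum.mono_neutral_left[OF fin I_sub], rule ballI)
          fix K assume "K \<in> [{..<n}]\<^bsup>k\<^esup> - I"
          then have "degree (induced E K) v \<notin> T" if "v \<in> K" for v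
            using that by (auto simp: I_def T_def)
          then show "weight k ?P K = 0"
            using pT[OF bdens_bounds] by (simp add: weight_def)
        qed
        have "\<exists>M\<subseteq>I. pairwise (\<lambda>K L. disjnt ([K]\<^bsup>2\<^esup>) ([L]\<^bsup>2\<^esup>)) M \<and>
          real (card M) \<ge> sum (weight k ?P) I - \<delta> / (3 * R) * real (card ([{..<n}]\<^bsup>2\<^esup>))"
        proof (rule round)
          show "finite ([{..<n}]\<^bsup>2\<^esup>)" by (simp add: finite_imp_finite_nsets)
          show "finite I" using I_sub fin finite_subset by blast
          show "[K]\<^bsup>2\<^esup> \<subseteq> [{..<n}]\<^bsup>2\<^esup> \<and> card ([K]\<^bsup>2\<^esup>) = k choose 2" if "K \<in> I" for K
            using that by (auto simp: I_def nsets_def card_nsets[unfolded nsets_def])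
          show "0 \<le> weight k ?P K" if "K \<in> I" for K using that I_sub w0 by auto
          show "(\<Sum>K | K \<in> I \<and> f \<in> [K]\<^bsup>2\<^esup>. weight k ?P K) \<le> 1" if f: "f \<in> [{..<n}]\<^bsup>2\<^esup>" for f
          proof (rule order.trans[OF sum_mono2 sum_weight_edge_le[OF k P f]])
            show "{K. K \<in> I \<and> f \<in> [K]\<^bsup>2\<^esup>} \<subseteq> {K. K \<in> [{..<n}]\<^bsup>k\<^esup> \<and> f \<subseteq> K}"
              using I_sub nsets_2_subset_iff[OF f] by auto
          qed (use fin w0 in auto)
          show "(\<Sum>K | K \<in> I \<and> f \<in> [K]\<^bsup>2\<^esup> \<and> g \<in> [K]\<^bsup>2\<^esup>. weight k ?P K) \<le> \<kappa>"
            if f: "f \<in> [{..<n}]\<^bsup>2\<^esup>" and g: "g \<in> [{..<n}]\<^bsup>2\<^esup>" and fg: "f \<noteq> g" for f g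
          proof -
            have "(\<Sum>K | K \<in> I \<and> f \<in> [K]\<^bsup>2\<^esup> \<and> g \<in> [K]\<^bsup>2\<^esup>. weight k ?P K) \<le>
              (\<Sum>K | K \<in> [{..<n}]\<^bsup>k\<^esup> \<and> f \<subseteq> K \<and> g \<subseteq> K. weight k ?P K)"
              using I_sub nsets_2_subset_iff[OF f] nsets_2_subset_iff[OF g] fin w0
              by (intro sum_mono2) auto
            also have "\<dots> \<le> real k * C / real n"
              using sum_weight_pair_le[OF k P f g fg] by simp
            also have "\<dots> \<le> \<kappa>" using n \<kappa> by (simp add: field_simps)
            finally show ?thesis .
          qed
        qed
        then obtain M where M: "M \<subseteq> I" "pairwise (\<lambda>K L. disjnt ([K]\<^bsup>2\<^esup>) ([L]\<^bsup>2\<^esup>)) M"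
          "real (card M) \<ge> sum (weight k ?P) I - \<delta> / (3 * R) * real (card ([{..<n}]\<^bsup>2\<^esup>))" by blast
        have pairs: "real (card ([{..<n}]\<^bsup>2\<^esup>)) = real n * (real n - 1) / 2"
        proof -
          have "even (n * (n - 1))" by (cases n) auto
          then have "2 * (n choose 2) = n * (n - 1)"
            unfolding choose_two by (rule dvd_mult_div_cancel)
          then have "real (2 * (n choose 2)) = real (n * (n - 1))" by (rule arg_cong)
          then show ?thesis using n by (simp add: card_nsets of_nat_diff)
        qed
        define m where "m = real n * (real n - 1)"
        have m: "0 \<le> m" "m \<le> real n ^ 2" using n by (auto simp: m_def power2_eq_square)
        have err: "2 * real k ^ 3 * C * real n \<le> \<delta> / 2 * m / R"
        proof -
          have "4 * real k ^ 3 * C * R \<le> (real n - 1) * \<delta>" using n \<delta> by (simp add: pos_divide_le_eq)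
          then have "real n * (4 * real k ^ 3 * C * R) \<le> real n * ((real n - 1) * \<delta>)"
            by (intro mult_left_mono) auto
          then show ?thesis using R by (simp add: m_def field_simps)
        qed
        have "m / R * (1 - \<epsilon>) \<le> m / R * (1 - \<delta>)" using m R \<delta> by (intro mult_left_mono) auto
        also have "\<dots> = m * (1 - \<delta> / 3) / R - \<delta> / 2 * m / R - \<delta> / (3 * R) * (m / 2)"
          using R by (simp add: field_simps)
        also have "\<dots> \<le> real n ^ 2 * (1 - d) ^ (k - 1) / R - 2 * real k ^ 3 * C * real n - \<delta> / (3 * R) * (m / 2)"
        proof -
          have "m * (1 - \<delta> / 3) \<le> real n ^ 2 * (1 - d) ^ (k - 1)"
            using m d_pow \<delta> by (intro mult_mono) auto
          then have "m * (1 - \<delta> / 3) / R \<le> real n ^ 2 * (1 - d) ^ (k - 1) / R"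
            using R by (intro divide_right_mono) auto
          then show ?thesis using err by linarith
        qed
        also have "\<dots> \<le> real (card M)"
          using M(3) sum_weight_lower[OF k P] n unfolding total pairs m_def R_def by fastforce
        finally have "real n * (real n - 1) / (real k * (real k - 1)) * (1 - \<epsilon>) \<le> real (card M)"
          by (simp add: m_def R_def)
        moreover have "is_packing k (\<C> k - degree_family S k) {..<n} E M"
          unfolding is_packing_def
        proof (intro conjI ballI)
          show "M \<subseteq> [{..<n}]\<^bsup>k\<^esup>" using M(1) I_sub by blast
          show "\<exists>c\<in>\<C> k - degree_family S k. \<exists>H\<in>c. coloring_iso A (induced E A) {..<k} H"
            if "A \<in> M" for A
            using that M(1) copy_outside_degree_family unfolding I_def by blast
        qed (rule M(2))
        ultimately show "\<exists>P. is_packing k (\<C> k - degree_family S k) {..<n} E P \<and>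
           real n * (real n - 1) / (real k * (real k - 1)) * (1 - \<epsilon>) \<le> real (card P)" by blast
      qed
    qed
  qed
  then show ?thesis by (auto simp: avoidable_def degree_family_def)
qed

end
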